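(* Let $a>1$ be an integer and let $\mu$ be a finitely supported probability measure on $\mathbf{Z}$ with $\gcd(\operatorname{supp}\mu-\operatorname{supp}\mu)=1$. Let $H=H(a,\mu)$ be the asymptotic entropy. Let $\varepsilon>0$, and for each integer $n\ge1$ let $\mathcal{P}_n$ be the set of primes $p$ such that $$\log p\leq(1/2-\varepsilon)Hn\quad\text{and}\quad\|\mu_n\bmod p-u_p\|\geq\varepsilon.$$ Then $$\sum_{p\in\mathcal{P}_n}\frac{\log p}{p}\ll_\varepsilon n^{1/2},$$ i.e. there is a constant $K$ depending only on $\varepsilon$, $a$ and $\mu$ such that the sum is at most $Kn^{1/2}$ for all $n\ge1$.
   Context: The measures $\mu_n$ on $\mathbf{Z}$ are defined by $\mu_0=\delta_0$ and $\mu_n=\mu*(m_a)_*\mu_{n-1}$ for $n\ge1$, where $m_a(x)=ax$; equivalently $\mu_n$ is the law of $\sum_{i=0}^{n-1}b_ia^i$ with $b_i$ i.i.d. of law $\mu$. The entropy of a finitely supported probability measure $\rho$ on $\mathbf Z$ is $H(\rho)=\sum_x\rho(\{x\})\log\rho(\{x\})^{-1}$ (natural logarithm), and the asymptotic entropy is $H(a,\mu)=\lim_{n\to\infty}\frac1nH(\mu_n)$. It is well known that the limit exists and $0<H(a,\mu)\le\min(\log a,H(\mu))$. $\mu_n\bmod p$ is the pushforward of $\mu_n$ to $\mathbf{Z}/p\mathbf{Z}$, $u_p$ is the uniform probability measure on $\mathbf{Z}/p\mathbf{Z}$, and $\|\cdot\|$ is the $l^1$ norm, $\|\rho\|=\sum_x|\rho(\{x\})|$.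 *)

theory Defs
  imports "HOL-Probability.Probability_Mass_Function" "HOL-Computational_Algebra.Primes"
begin

text \<open>Finitely supported probability measures on the integers are rendered as
  \<^typ>\<open>int pmf\<close> with finite \<^const>\<open>set_pmf\<close>.\<close>

definition conv_pmf :: "int pmf \<Rightarrow> int pmf \<Rightarrow> int pmf" where
  "conv_pmf \<mu> \<nu> = map_pmf (\<lambda>(x, y). x + y) (pair_pmf \<mu> \<nu>)"

primrec mu_seq :: "int \<Rightarrow> int pmf \<Rightarrow> nat \<Rightarrow> int pmf" where
  "mu_seq a \<mu> 0 = return_pmf 0"
| "mu_seq a \<mu> (Suc n) = conv_pmf \<mu> (map_pmf (\<lambda>x. a * x) (mu_seq a \<mu> n))"

text \<open>Entropy in nats; only meaningful for finitely supported \<open>\<rho>\<close>.\<close>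

definition pmf_entropy :: "int pmf \<Rightarrow> real" where
  "pmf_entropy \<rho> = (\<Sum>x\<in>set_pmf \<rho>. pmf \<rho> x * ln (inverse (pmf \<rho> x)))"

definition asymp_entropy :: "int \<Rightarrow> int pmf \<Rightarrow> real" where
  "asymp_entropy a \<mu> = lim (\<lambda>n. pmf_entropy (mu_seq a \<mu> n) / real n)"

text \<open>\<open>\<int>/p\<int>\<close> is represented by the residues \<open>{0..<p}\<close>, with \<open>mod\<close> as the quotient map.\<close>

definition mod_pmf :: "int pmf \<Rightarrow> nat \<Rightarrow> int pmf" where
  "mod_pmf \<rho> p = map_pmf (\<lambda>x. x mod int p) \<rho>"

definition unif_mod :: "nat \<Rightarrow> int pmf" where
  "unif_mod p = pmf_of_set {0..<int p}"

definition l1_norm_mod :: "nat \<Rightarrow> (int \<Rightarrow> real) \<Rightarrow> real" where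
  "l1_norm_mod p f = (\<Sum>x\<in>{0..<int p}. \<bar>f x\<bar>)"

definition bad_primes :: "int \<Rightarrow> int pmf \<Rightarrow> real \<Rightarrow> nat \<Rightarrow> nat set" where
  "bad_primes a \<mu> \<epsilon> n = {p. prime p \<and>
     ln (real p) \<le> (1/2 - \<epsilon>) * asymp_entropy a \<mu> * real n \<and>
     l1_norm_mod p (\<lambda>x. pmf (mod_pmf (mu_seq a \<mu> n) p) x - pmf (unif_mod p) x) \<ge> \<epsilon>}"

text \<open>Hence sums over \<^const>\<open>bad_primes\<close> are genuine finite sums.\<close>

lemma finite_bad_primes: "finite (bad_primes a \<mu> \<epsilon> n)"
proof -
  define C where "C = (1/2 - \<epsilon>) * asymp_entropy a \<mu> * real n"
  have "p \<le> nat \<lceil>exp C\<rceil>" if "prime p" "ln (real p) \<le> C" for p :: nat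
  proof -
    have "real p > 0" using prime_gt_0_nat[OF that(1)] by simp
    hence "real p = exp (ln (real p))" by simp
    also have "\<dots> \<le> exp C" using that(2) by simp
    finally show ?thesis by linarith
  qed
  hence "bad_primes a \<mu> \<epsilon> n \<subseteq> {..nat \<lceil>exp C\<rceil>}"
    by (auto simp: bad_primes_def C_def)
  thus ?thesis by (rule finite_subset) simp
qed

end

theory Submission
  imports Defs "HOL-Analysis.Harmonic_Numbers" "HOL-Real_Asymp.Real_Asymp"
begin

text \<open>Write \<open>H\<close> for the asymptotic entropy, \<open>b = a ^ s\<close> for a large constant \<open>s = L + g\<close>, and
\<open>N = n div (2 * s)\<close>.  Group the digits \<open>b\<^sub>i\<close> of \<open>\<Sum> b\<^sub>i a\<^sup>i\<close> into \<open>2 * N\<close> blocks of length \<open>s\<close>, and in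
each block separate the first \<open>L\<close> digits from the last \<open>g\<close>.  The first parts of the first \<open>N\<close> blocks
give a measure \<open>\<nu>\<close>, those of the other blocks a copy of \<open>\<nu>\<close> dilated by \<open>b ^ N\<close>, and the remaining
digits a measure \<open>Z\<close>, so that \<open>\<mu>\<^sub>n = \<nu> * (b ^ N \<cdot> \<nu>) * Z\<close> (\<open>mu_seq_block_decomposition\<close>).

If \<open>g\<close> is large enough that the first parts of distinct blocks cannot interfere, \<open>\<nu>\<close> is an injective
image of a product measure.  The asymptotic equipartition property then gives a set \<open>E\<close> of almost full
\<open>\<nu>\<close>-measure on which \<open>\<nu>\<close> is at most \<open>exp (- h * N)\<close> for any \<open>h < H * L\<close> (\<open>typical_set\<close>); as
\<open>L / s\<close> may be taken close to \<open>1\<close>, this is at most \<open>1 / p\<close> for all primes in question.  The factor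
\<open>1 / 2\<close> in the range of \<open>p\<close> is the price of having two independent copies of \<open>\<nu>\<close>.

The larger sieve (\<open>larger_sieve\<close>) bounds the collision probability of \<open>\<nu>\<close> modulo \<open>p\<close>: two distinct
points of \<open>E\<close> differ by at most \<open>exp (C * n)\<close>, hence the primes dividing their difference have total
logarithm at most \<open>C * n\<close>.  Therefore the collision probability is at most \<open>2 * sqrt n / p\<close> outside a
set of primes with \<open>\<Sum> ln p / p \<le> C * sqrt n\<close>.  This exceptional set is what produces \<open>sqrt n\<close>.

For any other \<open>p\<close>, Fourier inversion modulo \<open>p\<close> and Parseval's identity for the two copies of \<open>\<nu>\<close>
show that \<open>\<mu>\<^sub>n mod p\<close> is close to uniform as soon as the characteristic function of \<open>Z\<close> is at most a
small multiple of \<open>1 / sqrt n\<close> at all nonzero frequencies \<open>\<xi> / p\<close> (\<open>equidistribution_lower_bound\<close>,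
\<open>l1_norm_mod_conv3_le\<close>).  Otherwise some fraction \<open>\<xi> / p\<close> has the property that \<open>b ^ j * \<xi> / p\<close> is
near an integer for all but \<open>O (ln n)\<close> of the indices \<open>j < 2 * N\<close>, because by the gcd condition the
characteristic function of \<open>\<mu>\<close> is bounded away from \<open>1\<close> in absolute value away from the integers
(\<open>norm_charfn_bounded_away\<close>).  Such a fraction has an expansion in base \<open>b\<close> with few nontrivial
digits, so up to an error \<open>b ^ (- 2 * N)\<close> there are at most \<open>exp (O (ln n ^ 2))\<close> of them; since
\<open>b ^ (2 * N)\<close> exceeds the square of every \<open>p\<close>, the approximation determines the fraction and with it
\<open>p\<close> (\<open>card_primes_with_sparse_fraction\<close>).  So few primes contribute only a power of \<open>ln n\<close>.\<close>

section \<open>Convolution powers and expectations\<close>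

lemma conv_pmf_bind:
  "conv_pmf \<alpha> \<beta> = bind_pmf \<alpha> (\<lambda>x. bind_pmf \<beta> (\<lambda>y. return_pmf (x + y)))"
  by (simp add: conv_pmf_def pair_pmf_def map_pmf_def bind_assoc_pmf bind_return_pmf)

lemma conv_pmf_commute: "conv_pmf \<alpha> \<beta> = conv_pmf \<beta> \<alpha>"
  unfolding conv_pmf_bind by (subst bind_commute_pmf) (simp add: add.commute)

lemma conv_pmf_assoc: "conv_pmf (conv_pmf \<alpha> \<beta>) \<gamma> = conv_pmf \<alpha> (conv_pmf \<beta> \<gamma>)"
  unfolding conv_pmf_bind by (simp add: bind_assoc_pmf bind_return_pmf add.assoc)

lemma conv_pmf_left_commute: "conv_pmf \<alpha> (conv_pmf \<beta> \<gamma>) = conv_pmf \<beta> (conv_pmf \<alpha> \<gamma>)"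
  by (metis conv_pmf_assoc conv_pmf_commute)

lemmas conv_pmf_ac = conv_pmf_assoc conv_pmf_commute conv_pmf_left_commute

lemma conv_pmf_return_0: "conv_pmf (return_pmf 0) \<beta> = \<beta>"
  unfolding conv_pmf_bind by (simp add: bind_return_pmf bind_return_pmf')

lemma map_mult_conv_pmf:
  "map_pmf ((*) c) (conv_pmf \<alpha> \<beta>) = conv_pmf (map_pmf ((*) c) \<alpha>) (map_pmf ((*) c) \<beta>)"
  unfolding conv_pmf_bind
  by (simp add: map_pmf_def bind_assoc_pmf bind_return_pmf distrib_left)

lemma map_mult_map_mult:
  "map_pmf ((*) c) (map_pmf ((*) d) \<alpha>) = map_pmf ((*) (c * d)) (\<alpha> :: int pmf)"
  by (simp add: pmf.map_comp o_def mult.assoc[abs_def])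

lemma set_conv_pmf: "set_pmf (conv_pmf \<alpha> \<beta>) = (\<lambda>(x, y). x + y) ` (set_pmf \<alpha> \<times> set_pmf \<beta>)"
  by (simp add: conv_pmf_def)

lemma finite_mu_seq: "finite (set_pmf \<mu>) \<Longrightarrow> finite (set_pmf (mu_seq a \<mu> n))"
  by (induction n) (auto simp: set_conv_pmf)

lemma mu_seq_add:
  "mu_seq a \<mu> (m + n) = conv_pmf (mu_seq a \<mu> m) (map_pmf ((*) (a ^ m)) (mu_seq a \<mu> n))"
proof (induction m)
  case 0
  have "(*) (1::int) = id" by auto
  then show ?case by (simp add: conv_pmf_return_0 pmf.map_id)
next
  case (Suc m)
  then show ?case
    by (simp add: map_mult_conv_pmf map_mult_map_mult conv_pmf_assoc)
qed

text \<open>Grouping digits: \<open>s\<close> digits in base \<open>a\<close> make one digit in base \<open>a ^ s\<close>.\<close>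

lemma mu_seq_mult: "mu_seq a \<mu> (s * N) = mu_seq (a ^ s) (mu_seq a \<mu> s) N"
  by (induction N) (simp_all add: mu_seq_add)

text \<open>If each digit is an independent sum of two parts, then so is the whole random sum.  This is how a
block of digits is separated into its beginning and its end.\<close>

lemma mu_seq_conv:
  "mu_seq b (conv_pmf \<alpha> \<beta>) N = conv_pmf (mu_seq b \<alpha> N) (mu_seq b \<beta> N)"
  by (induction N) (simp_all add: conv_pmf_return_0 map_mult_conv_pmf conv_pmf_ac)

lemma mu_seq_abs_le:
  assumes a: "a > 1" and B: "\<And>x. x \<in> set_pmf \<mu> \<Longrightarrow> \<bar>x\<bar> \<le> B" and x: "x \<in> set_pmf (mu_seq a \<mu> n)"
  shows "\<bar>x\<bar> \<le> B * (a ^ n - 1)"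
  using x
proof (induction n arbitrary: x)
  case 0
  then show ?case by simp
next
  case (Suc n)
  then obtain y z where yz: "y \<in> set_pmf \<mu>" "z \<in> set_pmf (mu_seq a \<mu> n)" "x = y + a * z"
    by (auto simp: set_conv_pmf)
  have "\<bar>x\<bar> \<le> \<bar>y\<bar> + a * \<bar>z\<bar>" unfolding yz using abs_triangle_ineq[of y "a * z"] a by (simp add: abs_mult)
  also have "\<dots> \<le> B + a * (B * (a ^ n - 1))"
    using Suc.IH[OF yz(2)] B[OF yz(1)] a by (intro add_mono mult_left_mono) auto
  also have "\<dots> \<le> B * (a ^ Suc n - 1)"
  proof -
    have "B \<ge> 0" using B[OF yz(1)] by linarith
    then have "B * (a - 2) \<ge> 0" using a by simp
    then show ?thesis by (simp add: algebra_simps)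
  qed
  finally show ?case .
qed

text \<open>All measures below have finite support, so that integrals reduce to finite sums and Fubini's theorem
to an exchange of sums.\<close>

lemma expectation_finite_pmf:
  fixes f :: "'a \<Rightarrow> 'b::{banach,second_countable_topology}"
  assumes "finite (set_pmf \<rho>)"
  shows "measure_pmf.expectation \<rho> f = (\<Sum>x\<in>set_pmf \<rho>. pmf \<rho> x *\<^sub>R f x)"
  using assms by (subst integral_measure_pmf[of "set_pmf \<rho>"]) auto

lemma expectation_pair_pmf:
  fixes f :: "'a \<times> 'b \<Rightarrow> 'c::{banach,second_countable_topology}"
  assumes "finite (set_pmf \<alpha>)" "finite (set_pmf \<beta>)"
  shows "measure_pmf.expectation (pair_pmf \<alpha> \<beta>) f =
    measure_pmf.expectation \<alpha> (\<lambda>x. measure_pmf.expectation \<beta> (\<lambda>y. f (x, y)))"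
  using assms
  by (simp add: expectation_finite_pmf
      scaleR_sum_right sum.cartesian_product)
    (auto intro!: sum.cong simp: pmf_pair)

lemma expectation_conv_pmf:
  fixes f :: "int \<Rightarrow> 'c::{banach,second_countable_topology}"
  assumes "finite (set_pmf \<alpha>)" "finite (set_pmf \<beta>)"
  shows "measure_pmf.expectation (conv_pmf \<alpha> \<beta>) f =
    measure_pmf.expectation \<alpha> (\<lambda>x. measure_pmf.expectation \<beta> (\<lambda>y. f (x + y)))"
  using assms by (simp add: conv_pmf_def expectation_pair_pmf)

section \<open>Characteristic functions\<close>

text \<open>The argument is scaled by \<open>2 * pi\<close>, so that \<open>charfn \<rho>\<close> has period \<open>1\<close> and the Fourier
coefficients of \<open>\<rho> mod p\<close> are its values at the fractions \<open>\<xi> / p\<close>.\<close>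

definition charfn :: "int pmf \<Rightarrow> real \<Rightarrow> complex" where
  "charfn \<rho> \<theta> = measure_pmf.expectation \<rho> (\<lambda>x. cis (2 * pi * \<theta> * real_of_int x))"

lemma charfn_conv:
  assumes "finite (set_pmf \<alpha>)" "finite (set_pmf \<beta>)"
  shows "charfn (conv_pmf \<alpha> \<beta>) \<theta> = charfn \<alpha> \<theta> * charfn \<beta> \<theta>"
  unfolding charfn_def expectation_conv_pmf[OF assms]
  by (simp add: distrib_left cis_mult[symmetric])

lemma charfn_map_mult: "charfn (map_pmf ((*) c) \<alpha>) \<theta> = charfn \<alpha> (real_of_int c * \<theta>)"
  by (simp add: charfn_def mult_ac)

lemma charfn_mu_seq:
  assumes "finite (set_pmf \<mu>)"
  shows "charfn (mu_seq b \<mu> N) \<theta> = (\<Prod>j<N. charfn \<mu> (real_of_int b ^ j * \<theta>))"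
proof (induction N arbitrary: \<theta>)
  case 0
  then show ?case by (simp add: charfn_def)
next
  case (Suc N)
  have "charfn (mu_seq b \<mu> (Suc N)) \<theta> = charfn \<mu> \<theta> * charfn (mu_seq b \<mu> N) (b * \<theta>)"
    using assms finite_mu_seq[OF assms] by (simp add: charfn_conv charfn_map_mult)
  also have "\<dots> = (\<Prod>j<Suc N. charfn \<mu> (real_of_int b ^ j * \<theta>))"
    unfolding Suc.IH by (subst prod.lessThan_Suc_shift) (simp add: mult_ac)
  finally show ?case .
qed

lemma norm_charfn_le_1: "norm (charfn \<rho> \<theta>) \<le> 1"
proof -
  have "norm (charfn \<rho> \<theta>) \<le> measure_pmf.expectation \<rho> (\<lambda>x. norm (cis (2 * pi * \<theta> * real_of_int x)))"
    unfolding charfn_def by (rule integral_norm_bound)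
  then show ?thesis by simp
qed

lemma charfn_add_int: "charfn \<rho> (\<theta> + of_int k) = charfn \<rho> \<theta>"
proof -
  have "cis (2 * pi * (\<theta> + of_int k) * real_of_int x) = cis (2 * pi * \<theta> * real_of_int x)" for x
  proof -
    have "cis (2 * pi * (\<theta> + of_int k) * real_of_int x)
        = cis (2 * pi * \<theta> * real_of_int x) * cis (2 * pi * real_of_int (k * x))"
      by (simp add: cis_mult algebra_simps)
    then show ?thesis by (simp add: cis_multiple_2pi)
  qed
  then show ?thesis by (simp add: charfn_def)
qed

section \<open>Fourier analysis modulo p\<close>

text \<open>Unlike \<open>charfn\<close>, this allows a measure to be restricted to a subset \<open>E\<close> of its support.\<close>

definition exp_sum :: "int set \<Rightarrow> (int \<Rightarrow> real) \<Rightarrow> real \<Rightarrow> complex" where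
  "exp_sum E f \<theta> = (\<Sum>x\<in>E. of_real (f x) * cis (2 * pi * \<theta> * real_of_int x))"

lemma charfn_eq_exp_sum: "finite (set_pmf \<rho>) \<Longrightarrow> charfn \<rho> \<theta> = exp_sum (set_pmf \<rho>) (pmf \<rho>) \<theta>"
  by (simp add: charfn_def exp_sum_def expectation_finite_pmf scaleR_conv_of_real)

lemma sum_cis_mod:
  fixes p :: nat and m :: int
  assumes "p > 0"
  shows "(\<Sum>\<xi><p. cis (2 * pi * (real \<xi> / real p) * real_of_int m)) = (if int p dvd m then of_nat p else 0)"
proof -
  define z where "z = cis (2 * pi * (real_of_int m / real p))"
  have pow: "cis (2 * pi * (real \<xi> / real p) * real_of_int m) = z ^ \<xi>" for \<xi> :: nat
    unfolding z_def Complex.DeMoivre by (simp add: field_simps)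
  have z1: "z = 1 \<longleftrightarrow> int p dvd m"
  proof
    assume "z = 1"
    then have "cos (2 * pi * (real_of_int m / real p)) = 1"
      unfolding z_def by (simp add: complex_eq_iff)
    then obtain k :: int where "2 * pi * (real_of_int m / real p) = of_int k * 2 * pi"
      unfolding cos_one_2pi_int by blast
    then have "(2 * pi) * (real_of_int m / real p) = (2 * pi) * of_int k" by (simp only: mult_ac)
    then have "real_of_int m / real p = of_int k" by (subst (asm) mult_left_cancel) auto
    then have "real_of_int m = of_int (int p * k)" using assms by (simp add: field_simps)
    then show "int p dvd m" by (metis dvd_triv_left of_int_eq_iff)
  next
    assume "int p dvd m"
    then obtain k where "m = int p * k" ..
    then have "real_of_int m / real p = of_int k" using assms by simp
    then show "z = 1" unfolding z_def by (simp only: cis_multiple_2pi Ints_of_int)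
  qed
  show ?thesis
  proof (cases "int p dvd m")
    case True
    with z1 have "z = 1" by simp
    with True show ?thesis by (simp only: pow) simp
  next
    case False
    have "z ^ p = 1"
      unfolding z_def Complex.DeMoivre using assms by (simp add: cis_multiple_2pi)
    then have "(\<Sum>\<xi><p. z ^ \<xi>) = 0" using False z1 by (simp add: geometric_sum)
    with False show ?thesis by (simp only: pow) simp
  qed
qed

text \<open>Parseval's identity for the push-forward of \<open>f\<close> under \<open>x \<mapsto> c * x mod p\<close>, whose squared
\<open>l\<^sup>2\<close> norm is a weighted count of collisions modulo \<open>p\<close>.\<close>

lemma exp_sum_Parseval:
  fixes p :: nat and c :: int and f :: "int \<Rightarrow> real"
  assumes "finite E" "p > 0"
  shows "(\<Sum>\<xi><p. (norm (exp_sum E f (real_of_int c * (real \<xi> / real p))))\<^sup>2) =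
     p * (\<Sum>x\<in>E. \<Sum>y\<in>E. f x * f y * (if int p dvd c * (x - y) then 1 else 0))"
proof -
  have *: "of_real ((norm (exp_sum E f (real_of_int c * (real \<xi> / real p))))\<^sup>2) =
     (\<Sum>x\<in>E. \<Sum>y\<in>E. of_real (f x * f y) * cis (2 * pi * (real \<xi> / real p) * real_of_int (c * (x - y))))" for \<xi>
  proof -
    have "of_real ((norm (exp_sum E f (real_of_int c * (real \<xi> / real p))))\<^sup>2)
       = exp_sum E f (real_of_int c * (real \<xi> / real p)) * cnj (exp_sum E f (real_of_int c * (real \<xi> / real p)))"
      by (simp only: complex_norm_square)
    also have "\<dots> = (\<Sum>x\<in>E. \<Sum>y\<in>E. of_real (f x) * cis (2 * pi * (real_of_int c * (real \<xi> / real p)) * real_of_int x)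
         * (of_real (f y) * cis (- (2 * pi * (real_of_int c * (real \<xi> / real p)) * real_of_int y))))"
      unfolding exp_sum_def cnj_sum sum_product by (simp add: cis_cnj)
    also have "\<dots> = (\<Sum>x\<in>E. \<Sum>y\<in>E. of_real (f x * f y) * cis (2 * pi * (real \<xi> / real p) * real_of_int (c * (x - y))))"
    proof (intro sum.cong refl)
      fix x y
      have "cis (2 * pi * (real \<xi> / real p) * real_of_int (c * (x - y)))
        = cis (2 * pi * (real_of_int c * (real \<xi> / real p)) * real_of_int x) * cis (- (2 * pi * (real_of_int c * (real \<xi> / real p)) * real_of_int y))"
        unfolding cis_mult by (simp add: algebra_simps diff_divide_distrib add_divide_distrib)
      then show "of_real (f x) * cis (2 * pi * (real_of_int c * (real \<xi> / real p)) * real_of_int x)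
         * (of_real (f y) * cis (- (2 * pi * (real_of_int c * (real \<xi> / real p)) * real_of_int y)))
         = of_real (f x * f y) * cis (2 * pi * (real \<xi> / real p) * real_of_int (c * (x - y)))"
        by (simp only: of_real_mult mult_ac)
    qed
    finally show ?thesis .
  qed
  have "complex_of_real (\<Sum>\<xi><p. (norm (exp_sum E f (real_of_int c * (real \<xi> / real p))))\<^sup>2) =
     (\<Sum>\<xi><p. \<Sum>x\<in>E. \<Sum>y\<in>E. of_real (f x * f y) * cis (2 * pi * (real \<xi> / real p) * real_of_int (c * (x - y))))"
    by (simp only: of_real_sum *)
  also have "\<dots> = (\<Sum>x\<in>E. \<Sum>y\<in>E. of_real (f x * f y) * (\<Sum>\<xi><p. cis (2 * pi * (real \<xi> / real p) * real_of_int (c * (x - y)))))"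
    by (subst sum.swap, rule sum.cong[OF refl], subst sum.swap) (simp add: sum_distrib_left)
  also have "\<dots> = of_real (p * (\<Sum>x\<in>E. \<Sum>y\<in>E. f x * f y * (if int p dvd c * (x - y) then 1 else 0)))"
    unfolding sum_cis_mod[OF assms(2)] of_real_mult of_real_sum sum_distrib_left
    by (intro sum.cong refl) auto
  finally show ?thesis using of_real_eq_iff by blast
qed

text \<open>The right-hand side is the mass that the convolution of \<open>f\<close>, its dilate by \<open>M\<close> and \<open>\<zeta>\<close> gives to the
residue class of \<open>t\<close>.  In its Fourier expansion the frequency \<open>0\<close> contributes the expected amount.
The others contribute at most \<open>\<kappa>\<close> times \<open>\<Sum> \<bar>A\<bar> * \<bar>B\<bar>\<close>, where \<open>A\<close> and \<open>B\<close> are the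
transforms of \<open>f\<close> and of its dilate, and Parseval's identity bounds this by the collision count;
having two copies of \<open>f\<close> is what makes an \<open>l\<^sup>2\<close> bound sufficient.\<close>

lemma equidistribution_lower_bound:
  fixes p :: nat and M t :: int and f \<zeta> :: "int \<Rightarrow> real" and c \<kappa> :: real
  assumes fin: "finite E" "finite Z" and p: "p > 0" and cop: "coprime (int p) M"
    and Z1: "(\<Sum>z\<in>Z. \<zeta> z) = 1"
    and coll: "(\<Sum>x\<in>E. \<Sum>y\<in>E. f x * f y * (if int p dvd x - y then 1 else 0)) \<le> c / p"
    and small: "\<And>\<xi>. 0 < \<xi> \<Longrightarrow> \<xi> < p \<Longrightarrow> norm (exp_sum Z \<zeta> (real \<xi> / real p)) \<le> \<kappa>" and k0: "\<kappa> \<ge> 0"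
  shows "((\<Sum>x\<in>E. f x)\<^sup>2 - c * \<kappa>) / p \<le>
    (\<Sum>x\<in>E. \<Sum>y\<in>E. \<Sum>z\<in>Z. f x * f y * \<zeta> z * (if int p dvd x + M * y + z - t then 1 else 0))"
    (is "_ \<le> ?S")
proof -
  define A where "A \<xi> = exp_sum E f (real \<xi> / real p)" for \<xi> :: nat
  define B where "B \<xi> = exp_sum E f (real_of_int M * (real \<xi> / real p))" for \<xi> :: nat
  define C where "C \<xi> = exp_sum Z \<zeta> (real \<xi> / real p)" for \<xi> :: nat
  define D where "D \<xi> = cis (- (2 * pi * (real \<xi> / real p) * real_of_int t))" for \<xi> :: nat
  have prod: "A \<xi> * B \<xi> * C \<xi> * D \<xi> = (\<Sum>x\<in>E. \<Sum>y\<in>E. \<Sum>z\<in>Z. of_real (f x * f y * \<zeta> z) *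
      cis (2 * pi * (real \<xi> / real p) * real_of_int (x + M * y + z - t)))" for \<xi>
  proof -
    have "A \<xi> * B \<xi> * C \<xi> * D \<xi> = (\<Sum>x\<in>E. \<Sum>y\<in>E. \<Sum>z\<in>Z. 
       (of_real (f x) * cis (2 * pi * (real \<xi> / real p) * real_of_int x)) *
       (of_real (f y) * cis (2 * pi * (real_of_int M * (real \<xi> / real p)) * real_of_int y)) *
       (of_real (\<zeta> z) * cis (2 * pi * (real \<xi> / real p) * real_of_int z)) * D \<xi>)"
      unfolding A_def B_def C_def exp_sum_def
      by (simp only: sum_distrib_left[symmetric] sum_distrib_right[symmetric])
    also have "\<dots> = (\<Sum>x\<in>E. \<Sum>y\<in>E. \<Sum>z\<in>Z. of_real (f x * f y * \<zeta> z) *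
      cis (2 * pi * (real \<xi> / real p) * real_of_int (x + M * y + z - t)))"
    proof (intro sum.cong refl)
      fix x y z
      have "cis (2 * pi * (real \<xi> / real p) * real_of_int (x + M * y + z - t)) =
         cis (2 * pi * (real \<xi> / real p) * real_of_int x) * cis (2 * pi * (real_of_int M * (real \<xi> / real p)) * real_of_int y)
         * cis (2 * pi * (real \<xi> / real p) * real_of_int z) * D \<xi>"
        unfolding D_def cis_mult by (simp add: algebra_simps diff_divide_distrib add_divide_distrib)
      then show "(of_real (f x) * cis (2 * pi * (real \<xi> / real p) * real_of_int x)) *
       (of_real (f y) * cis (2 * pi * (real_of_int M * (real \<xi> / real p)) * real_of_int y)) *
       (of_real (\<zeta> z) * cis (2 * pi * (real \<xi> / real p) * real_of_int z)) * D \<xi> = of_real (f x * f y * \<zeta> z) *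
      cis (2 * pi * (real \<xi> / real p) * real_of_int (x + M * y + z - t))"
        by (simp only: of_real_mult mult_ac)
    qed
    finally show ?thesis .
  qed
  have inv: "complex_of_real (p * ?S) = (\<Sum>\<xi><p. A \<xi> * B \<xi> * C \<xi> * D \<xi>)"
  proof -
    have "(\<Sum>\<xi><p. A \<xi> * B \<xi> * C \<xi> * D \<xi>) = (\<Sum>x\<in>E. \<Sum>y\<in>E. \<Sum>z\<in>Z. of_real (f x * f y * \<zeta> z) *
      (\<Sum>\<xi><p. cis (2 * pi * (real \<xi> / real p) * real_of_int (x + M * y + z - t))))"
      unfolding prod
      by (subst sum.swap, rule sum.cong[OF refl], subst sum.swap, rule sum.cong[OF refl], subst sum.swap)
         (simp add: sum_distrib_left)
    also have "\<dots> = of_real (p * ?S)"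
      unfolding sum_cis_mod[OF p] of_real_mult of_real_sum sum_distrib_left
      by (intro sum.cong refl) auto
    finally show ?thesis by simp
  qed
  have zero: "A 0 * B 0 * C 0 * D 0 = of_real ((\<Sum>x\<in>E. f x)\<^sup>2)"
    using Z1 by (simp add: A_def B_def C_def D_def exp_sum_def power2_eq_square flip: of_real_sum)
  have split: "(\<Sum>\<xi><p. A \<xi> * B \<xi> * C \<xi> * D \<xi>) = of_real ((\<Sum>x\<in>E. f x)\<^sup>2) + (\<Sum>\<xi>\<in>{0<..<p}. A \<xi> * B \<xi> * C \<xi> * D \<xi>)"
  proof -
    have "{..<p} = insert 0 {0<..<p}" using p by auto
    then show ?thesis using zero by simp
  qed
  have PA: "(\<Sum>\<xi><p. (norm (A \<xi>))\<^sup>2) \<le> c"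
    using exp_sum_Parseval[OF fin(1) p, of f 1] coll p by (simp add: A_def field_simps)
  have "int p dvd M * (x - y) \<longleftrightarrow> int p dvd x - y" for x y
    using cop by (simp add: coprime_dvd_mult_right_iff)
  then have PB: "(\<Sum>\<xi><p. (norm (B \<xi>))\<^sup>2) \<le> c"
    using exp_sum_Parseval[OF fin(1) p, of f M] coll p by (simp add: B_def field_simps)
  have "norm (\<Sum>\<xi>\<in>{0<..<p}. A \<xi> * B \<xi> * C \<xi> * D \<xi>) \<le> (\<Sum>\<xi>\<in>{0<..<p}. \<kappa> * (((norm (A \<xi>))\<^sup>2 + (norm (B \<xi>))\<^sup>2) / 2))"
  proof (rule sum_norm_le)
    fix \<xi> assume \<xi>: "\<xi> \<in> {0<..<p}"
    have "norm (A \<xi> * B \<xi> * C \<xi> * D \<xi>) = norm (C \<xi>) * (norm (A \<xi>) * norm (B \<xi>))"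
      by (simp add: norm_mult D_def)
    also have "\<dots> \<le> \<kappa> * (((norm (A \<xi>))\<^sup>2 + (norm (B \<xi>))\<^sup>2) / 2)"
      using small[of \<xi>] \<xi> sum_squares_bound[of "norm (A \<xi>)" "norm (B \<xi>)"] k0
      by (intro mult_mono) (auto simp: C_def)
    finally show "norm (A \<xi> * B \<xi> * C \<xi> * D \<xi>) \<le> \<kappa> * (((norm (A \<xi>))\<^sup>2 + (norm (B \<xi>))\<^sup>2) / 2)" .
  qed
  also have "\<dots> \<le> (\<Sum>\<xi><p. \<kappa> * (((norm (A \<xi>))\<^sup>2 + (norm (B \<xi>))\<^sup>2) / 2))"
    using k0 by (intro sum_mono2) auto
  also have "\<dots> = \<kappa> * (((\<Sum>\<xi><p. (norm (A \<xi>))\<^sup>2) + (\<Sum>\<xi><p. (norm (B \<xi>))\<^sup>2)) / 2)"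
    by (simp only: sum_distrib_left[symmetric] sum.distrib[symmetric] sum_divide_distrib[symmetric])
  also have "\<dots> \<le> \<kappa> * c"
    using PA PB k0 by (intro mult_left_mono) auto
  finally have err: "norm (\<Sum>\<xi>\<in>{0<..<p}. A \<xi> * B \<xi> * C \<xi> * D \<xi>) \<le> \<kappa> * c" .
  have "complex_of_real (p * ?S - (\<Sum>x\<in>E. f x)\<^sup>2) = (\<Sum>\<xi>\<in>{0<..<p}. A \<xi> * B \<xi> * C \<xi> * D \<xi>)"
    using inv split by simp
  then have "\<bar>p * ?S - (\<Sum>x\<in>E. f x)\<^sup>2\<bar> \<le> \<kappa> * c"
    using err by (simp only: norm_of_real flip: \<open>complex_of_real (p * ?S - (\<Sum>x\<in>E. f x)\<^sup>2) = _\<close>)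
  then have "(\<Sum>x\<in>E. f x)\<^sup>2 - c * \<kappa> \<le> p * ?S" by (simp add: mult.commute)
  then show ?thesis using p by (simp add: divide_le_eq mult.commute)
qed

section \<open>Entropy\<close>

lemma pmf_entropy_eq_expectation:
  "finite (set_pmf \<rho>) \<Longrightarrow> pmf_entropy \<rho> = measure_pmf.expectation \<rho> (\<lambda>x. - ln (pmf \<rho> x))"
  by (simp add: pmf_entropy_def expectation_finite_pmf ln_inverse pmf_positive sum_negf)

lemma ln_pmf_nonpos: "ln (pmf \<rho> x) \<le> 0"
  by (cases "pmf \<rho> x = 0") (auto simp: pmf_le_1 ln_le_zero_iff pmf_pos)

lemma pmf_entropy_nonneg: "finite (set_pmf \<rho>) \<Longrightarrow> 0 \<le> pmf_entropy \<rho>"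
  unfolding pmf_entropy_eq_expectation
  by (rule integral_nonneg_AE) (simp add: ln_pmf_nonpos)

lemma pmf_le_pmf_map: "pmf \<rho> x \<le> pmf (map_pmf f \<rho>) (f x)"
proof -
  have "measure_pmf.prob \<rho> {x} \<le> measure_pmf.prob \<rho> (f -` {f x})"
    by (rule measure_pmf.finite_measure_mono) auto
  then show ?thesis by (simp add: pmf_map measure_pmf_single)
qed

lemma expectation_mono_pmf:
  fixes f g :: "'a \<Rightarrow> real"
  assumes "finite (set_pmf \<rho>)" "\<And>x. x \<in> set_pmf \<rho> \<Longrightarrow> f x \<le> g x"
  shows "measure_pmf.expectation \<rho> f \<le> measure_pmf.expectation \<rho> g"
  using assms by (auto simp: expectation_finite_pmf intro!: sum_mono mult_left_mono)

lemma expectation_add_pmf: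
  fixes f g :: "'a \<Rightarrow> real"
  assumes "finite (set_pmf \<rho>)"
  shows "measure_pmf.expectation \<rho> (\<lambda>x. f x + g x) = measure_pmf.expectation \<rho> f + measure_pmf.expectation \<rho> g"
  using assms by (simp add: expectation_finite_pmf sum.distrib distrib_left)

text \<open>The sum of two independent variables is a function of the pair, and every fibre has at least the mass
of each of its points; so the information content pointwise does not exceed that of the pair.\<close>

lemma pmf_entropy_conv_le:
  assumes fin: "finite (set_pmf \<alpha>)" "finite (set_pmf \<beta>)"
  shows "pmf_entropy (conv_pmf \<alpha> \<beta>) \<le> pmf_entropy \<alpha> + pmf_entropy \<beta>"
proof -
  let ?P = "pair_pmf \<alpha> \<beta>"
  have "pmf_entropy (conv_pmf \<alpha> \<beta>) = measure_pmf.expectation ?P (\<lambda>z. - ln (pmf (conv_pmf \<alpha> \<beta>) (fst z + snd z)))"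
    using fin by (subst pmf_entropy_eq_expectation) (auto simp: set_conv_pmf conv_pmf_def case_prod_unfold)
  also have "\<dots> \<le> measure_pmf.expectation ?P (\<lambda>z. - ln (pmf \<alpha> (fst z)) + - ln (pmf \<beta> (snd z)))"
  proof (rule expectation_mono_pmf)
    show "finite (set_pmf ?P)" using fin by simp
    fix z assume "z \<in> set_pmf ?P"
    then have pos: "pmf \<alpha> (fst z) > 0" "pmf \<beta> (snd z) > 0" by (auto simp: pmf_positive)
    have "pmf \<alpha> (fst z) * pmf \<beta> (snd z) \<le> pmf (conv_pmf \<alpha> \<beta>) (fst z + snd z)"
      using pmf_le_pmf_map[of ?P z "\<lambda>(x, y). x + y"]
      by (cases z) (simp add: conv_pmf_def pmf_pair)
    then have "ln (pmf \<alpha> (fst z) * pmf \<beta> (snd z)) \<le> ln (pmf (conv_pmf \<alpha> \<beta>) (fst z + snd z))"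
      using pos by (subst ln_le_cancel_iff) (auto intro: less_le_trans[OF mult_pos_pos])
    then show "- ln (pmf (conv_pmf \<alpha> \<beta>) (fst z + snd z)) \<le> - ln (pmf \<alpha> (fst z)) + - ln (pmf \<beta> (snd z))"
      using pos by (simp add: ln_mult)
  qed
  also have "\<dots> = pmf_entropy \<alpha> + pmf_entropy \<beta>"
    by (simp only: expectation_pair_pmf[OF fin] fst_conv snd_conv expectation_add_pmf[OF fin(2)]
        expectation_add_pmf[OF fin(1)] pmf_entropy_eq_expectation[OF fin(1)] pmf_entropy_eq_expectation[OF fin(2)]) simp
  finally show ?thesis .
qed

lemma pmf_entropy_map_le:
  assumes fin: "finite (set_pmf \<rho>)"
  shows "pmf_entropy (map_pmf f \<rho>) \<le> pmf_entropy \<rho>"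
proof -
  have "pmf_entropy (map_pmf f \<rho>) = measure_pmf.expectation \<rho> (\<lambda>x. - ln (pmf (map_pmf f \<rho>) (f x)))"
    using fin by (subst pmf_entropy_eq_expectation) auto
  also have "\<dots> \<le> measure_pmf.expectation \<rho> (\<lambda>x. - ln (pmf \<rho> x))"
    using fin
  proof (rule expectation_mono_pmf)
    fix x assume "x \<in> set_pmf \<rho>"
    then show "- ln (pmf (map_pmf f \<rho>) (f x)) \<le> - ln (pmf \<rho> x)"
      using pmf_le_pmf_map[of \<rho> x f] pmf_positive[of x \<rho>] by (auto simp: ln_le_cancel_iff)
  qed
  also have "\<dots> = pmf_entropy \<rho>" using fin by (simp add: pmf_entropy_eq_expectation)
  finally show ?thesis .
qed

text \<open>Jensen's inequality, in the form of \<open>ln x \<le> x - 1\<close> applied to \<open>1 / (pmf \<rho> x * card S)\<close>.\<close>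

lemma pmf_entropy_le_ln_card:
  assumes "finite S" "set_pmf \<rho> \<subseteq> S"
  shows "pmf_entropy \<rho> \<le> ln (card S)"
proof -
  have fin: "finite (set_pmf \<rho>)" using assms finite_subset by auto
  have c: "real (card S) > 0" 
    using assms set_pmf_not_empty[of \<rho>] by (simp add: card_gt_0_iff) blast
  have "pmf_entropy \<rho> - ln (card S) = (\<Sum>x\<in>set_pmf \<rho>. pmf \<rho> x * (ln (inverse (pmf \<rho> x)) - ln (card S)))"
    by (simp add: pmf_entropy_def right_diff_distrib sum_subtractf sum_pmf_eq_1[OF fin] flip: sum_distrib_right)
  also have "\<dots> \<le> (\<Sum>x\<in>set_pmf \<rho>. 1 / card S - pmf \<rho> x)"
  proof (rule sum_mono)
    fix x assume x: "x \<in> set_pmf \<rho>"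
    then have p: "pmf \<rho> x > 0" by (rule pmf_positive)
    have "ln (inverse (pmf \<rho> x)) - ln (card S) = ln (1 / (pmf \<rho> x * card S))"
      using p c by (simp add: ln_div ln_mult ln_inverse)
    also have "\<dots> \<le> 1 / (pmf \<rho> x * card S) - 1"
      using p c by (intro ln_le_minus_one) auto
    finally have "pmf \<rho> x * (ln (inverse (pmf \<rho> x)) - ln (card S)) \<le> pmf \<rho> x * (1 / (pmf \<rho> x * card S) - 1)"
      using p by (intro mult_left_mono) auto
    also have "\<dots> = 1 / card S - pmf \<rho> x" using p c by (simp add: field_simps)
    finally show "pmf \<rho> x * (ln (inverse (pmf \<rho> x)) - ln (card S)) \<le> 1 / card S - pmf \<rho> x" .
  qed
  also have "\<dots> = card (set_pmf \<rho>) / card S - 1"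
    by (simp add: sum_subtractf sum_pmf_eq_1[OF fin])
  also have "\<dots> \<le> 0"
    using c card_mono[OF assms] by (simp add: divide_le_eq)
  finally show ?thesis by simp
qed

text \<open>Fekete's lemma for nonnegative sequences: the limit is the infimum \<open>l\<close> of \<open>x n / n\<close>, because
\<open>n = (n div m) * m + n mod m\<close> gives \<open>x n \<le> n * (x m / m) + O(1)\<close> for each fixed \<open>m\<close>.\<close>

lemma subadditive_limit:
  fixes x :: "nat \<Rightarrow> real"
  assumes sub: "\<And>m n. x (m + n) \<le> x m + x n" and nonneg: "\<And>n. 0 \<le> x n"
  shows "\<exists>l. (\<lambda>n. x n / n) \<longlonglongrightarrow> l \<and> (\<forall>n\<ge>1. l * n \<le> x n)"
proof -
  define l where "l = (INF n\<in>{1..}. x n / real n)"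
  have bdd: "bdd_below ((\<lambda>n. x n / real n) ` {1..})"
    by (rule bdd_belowI2[of _ 0]) (simp add: nonneg)
  have lower: "l \<le> x n / n" if "n \<ge> 1" for n
    unfolding l_def using that by (intro cINF_lower bdd) auto
  have mult: "x (q * m) \<le> q * x m + x 0" for q m
  proof (induction q)
    case (Suc q)
    have "x (Suc q * m) \<le> x m + x (q * m)" using sub[of m "q * m"] by simp
    then show ?case using Suc by (simp add: algebra_simps)
  qed simp
  have "(\<lambda>n. x n / n) \<longlonglongrightarrow> l"
  proof (rule LIMSEQ_I)
    fix r :: real assume r: "r > 0"
    have "\<exists>m\<in>{1..}. x m / real m < l + r / 2"
      using r cINF_less_iff[OF _ bdd, of "l + r/2"] by (auto simp: l_def)
    then obtain m :: nat where m: "m \<ge> 1" "x m / m < l + r / 2" by auto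
    define C where "C = x 0 + Max (x ` {..<m})"
    have C: "x n \<le> n * (x m / m) + C" for n
    proof -
      have "x n \<le> x ((n div m) * m) + x (n mod m)"
        using sub[of "(n div m) * m" "n mod m"] by simp
      also have "\<dots> \<le> (n div m) * x m + x 0 + Max (x ` {..<m})"
        using m(1) by (intro add_mono mult Max_ge) auto
      also have "\<dots> \<le> n * (x m / m) + C"
      proof -
        have "real (n div m) \<le> n / m" using of_nat_div_le_of_nat by blast
        then have "real (n div m) * x m \<le> n / m * x m" by (rule mult_right_mono) (rule nonneg)
        then show ?thesis by (simp add: C_def)
      qed
      finally show ?thesis .
    qed
    obtain n0 :: nat where n0: "n0 > 2 * \<bar>C\<bar> / r" using reals_Archimedean2 by blast
    show "\<exists>no. \<forall>n\<ge>no. norm (x n / real n - l) < r"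
    proof (intro exI allI impI)
      fix n :: nat assume n: "n \<ge> max 1 n0"
      then have npos: "real n > 0" by simp
      have "2 * \<bar>C\<bar> / r < n" using n0 n by linarith
      then have "C / n < r / 2" using npos r by (simp add: field_simps)
      moreover have "x n / n \<le> x m / m + C / n"
        using C[of n] npos by (simp add: field_simps)
      moreover have "l \<le> x n / n" using n by (intro lower) simp
      ultimately show "norm (x n / real n - l) < r"
        unfolding real_norm_def using m(2) by linarith
    qed
  qed
  moreover have "l * n \<le> x n" if "n \<ge> 1" for n
    using lower[OF that] that by (simp add: field_simps)
  ultimately show ?thesis by blast
qed

text \<open>The limit defining the asymptotic entropy exists by subadditivity and is an infimum.  Being a lower
bound for the entropy at every finite level is what allows it to be realised by blocks of a fixed
length \<open>L\<close>.  The upper bound \<open>ln a\<close> comes from the size of the support.\<close>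

lemma asymp_entropy_props:
  assumes a: "a > 1" and fin: "finite (set_pmf \<mu>)"
  shows asymp_entropy_le: "\<And>n. asymp_entropy a \<mu> * real n \<le> pmf_entropy (mu_seq a \<mu> n)"
    and asymp_entropy_nonneg: "0 \<le> asymp_entropy a \<mu>"
    and asymp_entropy_le_ln: "asymp_entropy a \<mu> \<le> ln (real_of_int a)"
proof -
  let ?x = "\<lambda>n. pmf_entropy (mu_seq a \<mu> n)"
  note fin' = finite_mu_seq[OF fin]
  have sub: "?x (m + n) \<le> ?x m + ?x n" for m n
  proof -
    have "?x (m + n) \<le> ?x m + pmf_entropy (map_pmf ((*) (a ^ m)) (mu_seq a \<mu> n))"
      unfolding mu_seq_add using fin' by (intro pmf_entropy_conv_le) auto
    also have "\<dots> \<le> ?x m + ?x n"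
      using pmf_entropy_map_le[OF fin'] by simp
    finally show ?thesis .
  qed
  obtain l where l: "(\<lambda>n. ?x n / n) \<longlonglongrightarrow> l" "\<forall>n\<ge>1. l * n \<le> ?x n"
    using subadditive_limit[of ?x] sub pmf_entropy_nonneg[OF fin'] by blast
  have H: "asymp_entropy a \<mu> = l"
    unfolding asymp_entropy_def using l(1) by (rule limI)
  show "asymp_entropy a \<mu> * real n \<le> ?x n" for n
    using l(2) H pmf_entropy_nonneg[OF fin', of a n] by (cases "n = 0") (auto simp del: mu_seq.simps)
  show "0 \<le> asymp_entropy a \<mu>"
    unfolding H by (rule LIMSEQ_le_const[OF l(1)]) (simp add: pmf_entropy_nonneg[OF fin'])
  define B where "B = Max (abs ` set_pmf \<mu>)"
  have B: "\<bar>x\<bar> \<le> B" if "x \<in> set_pmf \<mu>" for x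
    unfolding B_def using fin that by (intro Max_ge) auto
  have B0: "B \<ge> 0" using B set_pmf_not_empty[of \<mu>] by fastforce
  have up: "?x n \<le> ln (2 * B + 1) + n * ln (real_of_int a)" for n
  proof -
    define k where "k = card {- (B * (a ^ n - 1))..B * (a ^ n - 1)}"
    have "?x n \<le> ln k"
      unfolding k_def
    proof (rule pmf_entropy_le_ln_card)
      show "set_pmf (mu_seq a \<mu> n) \<subseteq> {- (B * (a ^ n - 1))..B * (a ^ n - 1)}"
        using mu_seq_abs_le[OF a B] by (auto simp: abs_le_iff minus_le_iff)
    qed simp
    also have "\<dots> \<le> ln ((2 * B + 1) * real_of_int a ^ n)"
    proof -
      have an: "a ^ n \<ge> 1" using a by simp
      have nn: "0 \<le> B * (a ^ n - 1)" using B0 an by simp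
      then have "int k = 2 * (B * (a ^ n - 1)) + 1"
        by (simp add: k_def)
      moreover have "2 * (B * (a ^ n - 1)) + 1 \<le> (2 * B + 1) * a ^ n" using B0 an by (simp add: algebra_simps)
      ultimately have "real_of_int (int k) \<le> real_of_int ((2 * B + 1) * a ^ n)" "int k > 0"
        using nn by (simp_all only: of_int_le_iff)
      then have "real k \<le> (2 * B + 1) * real_of_int a ^ n" "real k > 0" by simp_all
      then show ?thesis by (rule ln_mono)
    qed
    also have "\<dots> = ln (2 * B + 1) + n * ln (real_of_int a)"
      using B0 a by (simp add: ln_mult ln_realpow)
    finally show ?thesis .
  qed
  have "(\<lambda>n. ln (2 * B + 1) * (1 / real n) + ln (real_of_int a)) \<longlonglongrightarrow> ln (2 * B + 1) * 0 + ln (real_of_int a)"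
    by (intro tendsto_intros lim_1_over_n)
  moreover have "\<exists>N. \<forall>n\<ge>N. ?x n / n \<le> ln (2 * B + 1) * (1 / real n) + ln (real_of_int a)"
    using up by (intro exI[of _ 1]) (auto simp: field_simps)
  ultimately show "asymp_entropy a \<mu> \<le> ln (real_of_int a)"
    unfolding H using LIMSEQ_le[OF l(1)] by fastforce
qed

section \<open>Asymptotic equipartition\<close>

text \<open>If the digits lie in an interval shorter than \<open>b\<close>, the lowest digit can be read off modulo \<open>b\<close>, so
\<open>(y, x) \<mapsto> y + b * x\<close> is injective and probabilities multiply.\<close>

lemma pmf_mu_seq_Suc:
  assumes spread: "\<And>y y'. y \<in> set_pmf \<alpha> \<Longrightarrow> y' \<in> set_pmf \<alpha> \<Longrightarrow> \<bar>y - y'\<bar> < b"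
    and y: "y \<in> set_pmf \<alpha>" and x: "x \<in> set_pmf (mu_seq b \<alpha> N)"
  shows "pmf (mu_seq b \<alpha> (Suc N)) (y + b * x) = pmf \<alpha> y * pmf (mu_seq b \<alpha> N) x"
proof -
  let ?P = "pair_pmf \<alpha> (mu_seq b \<alpha> N)" and ?f = "\<lambda>(y, x). y + b * x"
  have eq: "mu_seq b \<alpha> (Suc N) = map_pmf ?f ?P"
    by (simp add: conv_pmf_def pair_map_pmf2 pmf.map_comp o_def case_prod_unfold apsnd_def map_prod_def)
  have "inj_on ?f (set_pmf ?P)"
  proof (rule inj_onI, clarsimp)
    fix y x y' x' assume y: "y \<in> set_pmf \<alpha>" "y' \<in> set_pmf \<alpha>" and e: "y + b * x = y' + b * x'"
    have b: "b > 0" using spread[OF y(1) y(1)] by simp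
    have "y - y' = b * (x' - x)" using e by (simp add: algebra_simps)
    then have "b dvd y - y'" by simp
    then have "y - y' = 0" using spread[OF y] b zdvd_imp_le[of b "\<bar>y - y'\<bar>"] by fastforce
    then show "y = y' \<and> x = x'" using e b by simp
  qed
  then have "pmf (map_pmf ?f ?P) (?f (y, x)) = pmf ?P (y, x)"
    using x y by (intro pmf_map_inj) auto
  then show ?thesis unfolding eq by (simp add: pmf_pair)
qed

lemma moment_mu_seq:
  fixes t :: real
  assumes fin: "finite (set_pmf \<alpha>)"
    and spread: "\<And>y y'. y \<in> set_pmf \<alpha> \<Longrightarrow> y' \<in> set_pmf \<alpha> \<Longrightarrow> \<bar>y - y'\<bar> < b"
  shows "measure_pmf.expectation (mu_seq b \<alpha> N) (\<lambda>x. pmf (mu_seq b \<alpha> N) x powr t) =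
    measure_pmf.expectation \<alpha> (\<lambda>y. pmf \<alpha> y powr t) ^ N"
proof (induction N)
  case 0
  then show ?case by simp
next
  case (Suc N)
  note fin' = finite_mu_seq[OF fin]
  have product: "pmf (mu_seq b \<alpha> (Suc N)) (y + b * x) = pmf \<alpha> y * pmf (mu_seq b \<alpha> N) x"
    if "y \<in> set_pmf \<alpha>" "x \<in> set_pmf (mu_seq b \<alpha> N)" for y x
    by (rule pmf_mu_seq_Suc[OF _ that]) (rule spread)
  have "measure_pmf.expectation (mu_seq b \<alpha> (Suc N)) (\<lambda>x. pmf (mu_seq b \<alpha> (Suc N)) x powr t)
    = measure_pmf.expectation \<alpha> (\<lambda>y. measure_pmf.expectation (mu_seq b \<alpha> N) 
        (\<lambda>x. pmf (mu_seq b \<alpha> (Suc N)) (y + b * x) powr t))"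
    using fin fin' by (subst mu_seq.simps(2), subst expectation_conv_pmf) simp_all
  also have "\<dots> = measure_pmf.expectation \<alpha> (\<lambda>y. measure_pmf.expectation (mu_seq b \<alpha> N) 
        (\<lambda>x. pmf \<alpha> y powr t * pmf (mu_seq b \<alpha> N) x powr t))"
    unfolding expectation_finite_pmf[OF fin] expectation_finite_pmf[OF fin']
    by (intro sum.cong refl arg_cong2[where f = "(*\<^sub>R)"]) (simp add: product powr_mult del: mu_seq.simps)
  also have "\<dots> = measure_pmf.expectation \<alpha> (\<lambda>y. pmf \<alpha> y powr t) ^ Suc N"
    using Suc.IH by simp
  finally show ?case .
qed

text \<open>Both sides are \<open>1\<close> at \<open>t = 0\<close>, and the left-hand side has the smaller derivative there:
the derivatives are \<open>- pmf_entropy \<alpha>\<close> and \<open>- h\<close>.\<close>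

lemma exists_moment_lt:
  assumes fin: "finite (set_pmf \<alpha>)" and h: "h < pmf_entropy \<alpha>"
  shows "\<exists>t>0. measure_pmf.expectation \<alpha> (\<lambda>y. pmf \<alpha> y powr t) < exp (- t * h)"
proof -
  define F where "F t = (\<Sum>y\<in>set_pmf \<alpha>. pmf \<alpha> y * pmf \<alpha> y powr t) - exp (- t * h)" for t :: real
  have "(F has_real_derivative (\<Sum>y\<in>set_pmf \<alpha>. pmf \<alpha> y * (pmf \<alpha> y powr 0 * ln (pmf \<alpha> y))) - exp (- 0 * h) * (- h)) (at 0)"
    unfolding F_def
    by (auto intro!: derivative_eq_intros DERIV_sum sum.cong simp: pmf_positive sum_distrib_left)
  moreover have "(\<Sum>y\<in>set_pmf \<alpha>. pmf \<alpha> y * (pmf \<alpha> y powr 0 * ln (pmf \<alpha> y))) = - pmf_entropy \<alpha>"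
    using fin by (auto simp: pmf_entropy_def ln_inverse pmf_positive set_pmf_iff simp flip: sum_negf intro!: sum.cong)
  ultimately have der: "(F has_real_derivative (h - pmf_entropy \<alpha>)) (at 0)"
    by simp
  have "h - pmf_entropy \<alpha> < 0" using h by simp
  then obtain d where d: "d > 0" "\<And>t. 0 < t \<Longrightarrow> t < d \<Longrightarrow> F (0 + t) < F 0"
    using DERIV_neg_dec_right[OF der] by blast
  have "F 0 = (\<Sum>y\<in>set_pmf \<alpha>. pmf \<alpha> y) - 1" unfolding F_def by (simp add: set_pmf_iff)
  then have "F 0 = 0" using fin by (simp add: sum_pmf_eq_1)
  then have "F (d / 2) < 0" using d(2)[of "d/2"] d(1) by simp
  then show ?thesis using d(1) fin
    by (intro exI[of _ "d/2"]) (auto simp: F_def expectation_finite_pmf)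
qed

text \<open>A Chernoff bound: the moments of \<open>moment_mu_seq\<close> are multiplicative, so the set where the probability
exceeds \<open>exp (- (h * N))\<close> has measure at most \<open>q ^ N\<close> for some \<open>q < 1\<close>.\<close>

lemma typical_set:
  fixes \<eta> h :: real
  assumes fin: "finite (set_pmf \<alpha>)"
    and spread: "\<And>y y'. y \<in> set_pmf \<alpha> \<Longrightarrow> y' \<in> set_pmf \<alpha> \<Longrightarrow> \<bar>y - y'\<bar> < b"
    and h: "h < pmf_entropy \<alpha>" and \<eta>: "\<eta> > 0"
  shows "\<exists>N0. \<forall>N\<ge>N0. \<exists>E \<subseteq> set_pmf (mu_seq b \<alpha> N).
     (\<Sum>x\<in>E. pmf (mu_seq b \<alpha> N) x) \<ge> 1 - \<eta> \<and> (\<forall>x\<in>E. pmf (mu_seq b \<alpha> N) x \<le> exp (- (h * N)))"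
proof -
  obtain t where t: "t > 0" "measure_pmf.expectation \<alpha> (\<lambda>y. pmf \<alpha> y powr t) < exp (- t * h)"
    using exists_moment_lt[OF fin h] by blast
  define W where "W = measure_pmf.expectation \<alpha> (\<lambda>y. pmf \<alpha> y powr t)"
  define q where "q = W * exp (t * h)"
  have W0: "W \<ge> 0" unfolding W_def by simp
  have "W * exp (t * h) < exp (- t * h) * exp (t * h)" using t(2) by (simp add: W_def)
  then have q: "0 \<le> q" "q < 1" using W0 by (simp_all add: q_def flip: exp_add)
  obtain N0 where N0: "q ^ N0 < \<eta>" using real_arch_pow_inv[OF \<eta> q(2)] by blast
  show ?thesis
  proof (intro exI[of _ N0] allI impI)
    fix N assume "N \<ge> N0"
    then have qN: "q ^ N < \<eta>" using power_decreasing[of N0 N q] q N0 by linarith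
    define \<nu> where "\<nu> = mu_seq b \<alpha> N"
    define T where "T = {x \<in> set_pmf \<nu>. pmf \<nu> x > exp (- (h * N))}"
    have fin\<nu>: "finite (set_pmf \<nu>)" unfolding \<nu>_def by (rule finite_mu_seq[OF fin])
    have "(\<Sum>x\<in>T. pmf \<nu> x) \<le> (\<Sum>x\<in>T. pmf \<nu> x * pmf \<nu> x powr t * exp (t * (h * N)))"
    proof (rule sum_mono)
      fix x assume x: "x \<in> T"
      then have "exp (- (h * N)) powr t \<le> pmf \<nu> x powr t"
        using t(1) by (intro powr_mono2) (auto simp: T_def)
      then have "exp (- (t * (h * N))) * exp (t * (h * N)) \<le> pmf \<nu> x powr t * exp (t * (h * N))"
        by (intro mult_right_mono) (simp_all add: powr_def)
      then have "1 \<le> pmf \<nu> x powr t * exp (t * (h * N))" by (simp flip: exp_add)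
      then show "pmf \<nu> x \<le> pmf \<nu> x * pmf \<nu> x powr t * exp (t * (h * N))"
        using mult_left_mono[of 1 "pmf \<nu> x powr t * exp (t * (h * N))" "pmf \<nu> x"] by (simp add: mult.assoc)
    qed
    also have "\<dots> \<le> (\<Sum>x\<in>set_pmf \<nu>. pmf \<nu> x * pmf \<nu> x powr t * exp (t * (h * N)))"
      using fin\<nu> by (intro sum_mono2) (auto simp: T_def)
    also have "\<dots> = W ^ N * exp (t * h) ^ N"
    proof -
      have "(\<Sum>x\<in>set_pmf \<nu>. pmf \<nu> x * pmf \<nu> x powr t) = W ^ N"
        using moment_mu_seq[OF fin spread, of N t] fin\<nu> by (simp add: \<nu>_def W_def expectation_finite_pmf)
      moreover have "exp (t * (h * N)) = exp (t * h) ^ N"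
        by (simp add: mult_ac flip: exp_of_nat_mult)
      ultimately show ?thesis by (simp only: flip: sum_distrib_right)
    qed
    also have "\<dots> = q ^ N" by (simp add: q_def power_mult_distrib)
    finally have "(\<Sum>x\<in>T. pmf \<nu> x) \<le> \<eta>" using qN by simp
    moreover have "(\<Sum>x\<in>set_pmf \<nu> - T. pmf \<nu> x) = 1 - (\<Sum>x\<in>T. pmf \<nu> x)"
      using fin\<nu> by (subst sum_diff) (auto simp: T_def sum_pmf_eq_1)
    ultimately show "\<exists>E \<subseteq> set_pmf (mu_seq b \<alpha> N).
       (\<Sum>x\<in>E. pmf (mu_seq b \<alpha> N) x) \<ge> 1 - \<eta> \<and> (\<forall>x\<in>E. pmf (mu_seq b \<alpha> N) x \<le> exp (- (h * N)))"
      unfolding \<nu>_def[symmetric]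
      by (intro exI[of _ "set_pmf \<nu> - T"]) (auto simp: T_def)
  qed
qed

section \<open>Characteristic functions away from the integers\<close>

text \<open>The integers \<open>d\<close> with \<open>d * \<theta> \<in> \<int>\<close> form an ideal, hence are closed under gcds.\<close>

lemma Gcd_mult_in_Ints:
  fixes \<theta> :: real
  assumes "finite F" "\<And>d. d \<in> F \<Longrightarrow> real_of_int d * \<theta> \<in> \<int>"
  shows "real_of_int (Gcd F) * \<theta> \<in> \<int>"
  using assms
proof (induction F rule: finite_induct)
  case empty
  then show ?case by simp
next
  case (insert d F)
  obtain u v where "u * d + v * Gcd F = gcd d (Gcd F)" using bezout_int by blast
  then have "real_of_int (gcd d (Gcd F)) * \<theta> = of_int u * (of_int d * \<theta>) + of_int v * (of_int (Gcd F) * \<theta>)"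
    by (simp only: of_int_add of_int_mult distrib_right mult.assoc flip: \<open>u * d + v * Gcd F = gcd d (Gcd F)\<close>)
  also have "\<dots> \<in> \<int>"
  proof -
    have "of_int d * \<theta> \<in> \<int>" "of_int (Gcd F) * \<theta> \<in> \<int>" using insert by auto
    then show ?thesis by (intro Ints_add[OF Ints_mult[OF Ints_of_int] Ints_mult[OF Ints_of_int]])
  qed
  finally show ?case by simp
qed

text \<open>Equality in the triangle inequality forces the phases \<open>cis (2 * pi * \<theta> * x)\<close> to agree on the support,
which means that \<open>(x - y) * \<theta>\<close> is always an integer; then so is \<open>\<theta>\<close>, by the gcd condition.\<close>

lemma norm_charfn_lt_1:
  assumes fin: "finite (set_pmf \<mu>)"
    and gcd: "Gcd {x - y | x y. x \<in> set_pmf \<mu> \<and> y \<in> set_pmf \<mu>} = 1"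
    and \<theta>: "\<theta> \<notin> \<int>"
  shows "norm (charfn \<mu> \<theta>) < 1"
proof (rule ccontr)
  assume "\<not> norm (charfn \<mu> \<theta>) < 1"
  then have n1: "norm (charfn \<mu> \<theta>) = 1" using norm_charfn_le_1[of \<mu> \<theta>] by linarith
  define v where "v = cnj (charfn \<mu> \<theta>)"
  define w where "w x = v * cis (2 * pi * \<theta> * real_of_int x)" for x
  have nw: "norm (w x) = 1" for x by (simp add: w_def v_def norm_mult n1)
  have re_le: "Re (w x) \<le> 1" for x using nw[of x] complex_Re_le_cmod[of "w x"] by simp
  have "v * charfn \<mu> \<theta> = 1"
    using complex_norm_square[of "charfn \<mu> \<theta>"] by (simp add: v_def n1 mult.commute)
  moreover have "v * charfn \<mu> \<theta> = (\<Sum>x\<in>set_pmf \<mu>. pmf \<mu> x *\<^sub>R w x)"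
    using fin by (simp add: charfn_def expectation_finite_pmf w_def sum_distrib_left)
  ultimately have "Re (\<Sum>x\<in>set_pmf \<mu>. pmf \<mu> x *\<^sub>R w x) = 1" by simp
  then have "(\<Sum>x\<in>set_pmf \<mu>. pmf \<mu> x * Re (w x)) = 1"
    by simp
  then have "(\<Sum>x\<in>set_pmf \<mu>. pmf \<mu> x * (1 - Re (w x))) = 0"
    using sum_pmf_eq_1[OF fin] by (simp add: right_diff_distrib sum_subtractf)
  then have "\<forall>x\<in>set_pmf \<mu>. pmf \<mu> x * (1 - Re (w x)) = 0"
    using fin re_le by (subst (asm) sum_nonneg_eq_0_iff) auto
  then have re: "Re (w x) = 1" if "x \<in> set_pmf \<mu>" for x
    using that by (auto simp: set_pmf_iff)
  have w1: "w x = 1" if "x \<in> set_pmf \<mu>" for x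
    using re[OF that] nw[of x] cmod_power2[of "w x"] by (simp add: complex_eq_iff)
  have "real_of_int d * \<theta> \<in> \<int>" if d: "d \<in> {x - y | x y. x \<in> set_pmf \<mu> \<and> y \<in> set_pmf \<mu>}" for d
  proof -
    obtain x y where xy: "d = x - y" "x \<in> set_pmf \<mu>" "y \<in> set_pmf \<mu>" using d by blast
    have "v \<noteq> 0" using n1 by (auto simp: v_def)
    moreover have "v * cis (2 * pi * \<theta> * real_of_int x) = v * cis (2 * pi * \<theta> * real_of_int y)"
      using w1[OF xy(2)] w1[OF xy(3)] by (simp only: w_def)
    ultimately have "cis (2 * pi * \<theta> * real_of_int x) = cis (2 * pi * \<theta> * real_of_int y)"
      by (subst (asm) mult_left_cancel)
    then have "cis (2 * pi * \<theta> * real_of_int x - 2 * pi * \<theta> * real_of_int y) = 1"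
      by (simp flip: cis_divide)
    then have "cos (2 * pi * \<theta> * real_of_int x - 2 * pi * \<theta> * real_of_int y) = 1"
      by (simp add: complex_eq_iff)
    then obtain k :: int where "2 * pi * \<theta> * real_of_int x - 2 * pi * \<theta> * real_of_int y = of_int k * 2 * pi"
      unfolding cos_one_2pi_int by blast
    then have "(2 * pi) * (real_of_int d * \<theta>) = (2 * pi) * of_int k" by (simp add: xy(1) algebra_simps)
    then have "real_of_int d * \<theta> = of_int k" by (subst (asm) mult_left_cancel) auto
    then show ?thesis by simp
  qed
  moreover have "finite {x - y | x y. x \<in> set_pmf \<mu> \<and> y \<in> set_pmf \<mu>}"
    using fin by (intro finite_image_set2) auto
  ultimately have "real_of_int 1 * \<theta> \<in> \<int>" unfolding gcd[symmetric] by (intro Gcd_mult_in_Ints)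
  then show False using \<theta> by simp
qed

text \<open>Compactness of \<open>{\<tau>..1 - \<tau>}\<close> together with periodicity.\<close>

lemma norm_charfn_bounded_away:
  assumes fin: "finite (set_pmf \<mu>)"
    and gcd: "Gcd {x - y | x y. x \<in> set_pmf \<mu> \<and> y \<in> set_pmf \<mu>} = 1"
    and \<tau>: "0 < \<tau>" "\<tau> \<le> 1 / 2"
  shows "\<exists>\<rho>. 0 < \<rho> \<and> \<rho> < 1 \<and> (\<forall>\<theta>. \<tau> \<le> \<bar>\<theta> - of_int (round \<theta>)\<bar> \<longrightarrow> norm (charfn \<mu> \<theta>) \<le> \<rho>)"
proof -
  have "continuous_on {\<tau>..1 - \<tau>} (\<lambda>\<theta>. norm (charfn \<mu> \<theta>))"
    unfolding charfn_def expectation_finite_pmf[OF fin] by (intro continuous_intros)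
  moreover have "compact {\<tau>..1 - \<tau>}" "{\<tau>..1 - \<tau>} \<noteq> {}" using \<tau> by auto
  ultimately obtain \<theta>0 where \<theta>0: "\<theta>0 \<in> {\<tau>..1 - \<tau>}" "\<And>\<theta>. \<theta> \<in> {\<tau>..1 - \<tau>} \<Longrightarrow> norm (charfn \<mu> \<theta>) \<le> norm (charfn \<mu> \<theta>0)"
    using continuous_attains_sup[of "{\<tau>..1 - \<tau>}" "\<lambda>\<theta>. norm (charfn \<mu> \<theta>)"] by blast
  have "\<theta>0 \<notin> \<int>"
  proof
    assume "\<theta>0 \<in> \<int>"
    then obtain k :: int where "\<theta>0 = of_int k" by (auto elim: Ints_cases)
    with \<theta>0(1) \<tau> have "0 < real_of_int k" "real_of_int k < 1" by auto
    then show False by simp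
  qed
  then have lt: "norm (charfn \<mu> \<theta>0) < 1" using norm_charfn_lt_1[OF fin gcd] by blast
  show ?thesis
  proof (intro exI[of _ "max (norm (charfn \<mu> \<theta>0)) (1/2)"] conjI allI impI)
    fix \<theta> :: real assume a: "\<tau> \<le> \<bar>\<theta> - of_int (round \<theta>)\<bar>"
    define e where "e = \<theta> - of_int (round \<theta>)"
    have e: "\<bar>e\<bar> \<le> 1 / 2" using of_int_round_abs_le[of \<theta>] by (simp add: e_def abs_minus_commute)
    have c1: "charfn \<mu> \<theta> = charfn \<mu> e" using charfn_add_int[of \<mu> e "round \<theta>"] by (simp add: e_def)
    have c2: "charfn \<mu> (e + 1) = charfn \<mu> e" using charfn_add_int[of \<mu> e 1] by simp
    have "norm (charfn \<mu> e) \<le> norm (charfn \<mu> \<theta>0)"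
    proof (cases "e \<ge> 0")
      case True
      then show ?thesis using a e \<tau> by (intro \<theta>0(2)) (auto simp: e_def[symmetric])
    next
      case False
      then show ?thesis unfolding c2[symmetric] using a e \<tau> by (intro \<theta>0(2)) (auto simp: e_def[symmetric])
    qed
    then show "norm (charfn \<mu> \<theta>) \<le> max (norm (charfn \<mu> \<theta>0)) (1/2)" by (simp add: c1)
  qed (use lt in auto)
qed

section \<open>Fractions with sparse expansions\<close>

text \<open>Contains every value of \<open>round (b ^ k * \<theta>)\<close> for \<open>\<theta> \<in> {0..1}\<close> when at most \<open>r\<close> of the \<open>k\<close> steps
\<open>round (b ^ j * \<theta>) \<mapsto> round (b ^ Suc j * \<theta>)\<close> differ from multiplication by \<open>b\<close>: a base-\<open>b\<close>
expansion with at most \<open>r\<close> nonzero signed digits.  The union over \<open>r'\<close> is empty if \<open>r = 0\<close>.\<close>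

primrec sparse_ints :: "int \<Rightarrow> nat \<Rightarrow> nat \<Rightarrow> int set" where
  "sparse_ints b 0 r = {0, 1}"
| "sparse_ints b (Suc k) r = (*) b ` sparse_ints b k r \<union>
     (\<Union>r'\<in>{r'. r = Suc r'}. \<Union>d\<in>{-b..b}. (\<lambda>v. b * v + d) ` sparse_ints b k r')"

text \<open>Induction on \<open>k\<close>, using \<open>X ^ r + B * X ^ (r - 1) \<le> (X + B) ^ r\<close> with \<open>B = 2 * b + 1\<close>, the
number of digits.\<close>

lemma card_sparse_ints:
  assumes b: "b > 0"
  shows "finite (sparse_ints b k r) \<and> card (sparse_ints b k r) \<le> 2 * (1 + nat (2 * b + 1) * k) ^ r"
proof (induction k arbitrary: r)
  case 0
  then show ?case by simp
next
  case (Suc k)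
  define B where "B = nat (2 * b + 1)"
  define X where "X = 1 + B * k"
  have X1: "1 + B * Suc k = X + B" by (simp add: X_def)
  have fin: "finite (sparse_ints b k r)" for r using Suc by blast
  have card: "card (sparse_ints b k r) \<le> 2 * X ^ r" for r using Suc by (simp add: X_def B_def)
  have c1: "card ((*) b ` sparse_ints b k r) \<le> 2 * X ^ r" for r
    using card_image_le[OF fin] card order_trans by blast
  show ?case
  proof (cases r)
    case 0
    then show ?thesis using fin c1[of 0] by simp
  next
    case (Suc r')
    have "card (\<Union>d\<in>{-b..b}. (\<lambda>v. b * v + d) ` sparse_ints b k r') \<le> (\<Sum>d\<in>{-b..b}. card ((\<lambda>v. b * v + d) ` sparse_ints b k r'))"
      by (rule card_UN_le) simp
    also have "\<dots> \<le> (\<Sum>d\<in>{-b..b}. 2 * X ^ r')"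
      using card_image_le[OF fin] card order_trans by (intro sum_mono) blast
    also have "\<dots> = B * (2 * X ^ r')" using b by (simp add: B_def)
    finally have c2: "card (\<Union>d\<in>{-b..b}. (\<lambda>v. b * v + d) ` sparse_ints b k r') \<le> B * (2 * X ^ r')" .
    have set: "sparse_ints b (Suc k) r = (*) b ` sparse_ints b k r \<union> (\<Union>d\<in>{-b..b}. (\<lambda>v. b * v + d) ` sparse_ints b k r')"
      using Suc by auto
    have "card (sparse_ints b (Suc k) r) \<le> 2 * X ^ r + B * (2 * X ^ r')"
      unfolding set using c1[of r] c2 by (intro order_trans[OF card_Un_le] add_mono)
    also have "\<dots> = 2 * ((X + B) * X ^ r')" using Suc by (simp add: algebra_simps)
    also have "\<dots> \<le> 2 * ((X + B) * (X + B) ^ r')"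
      by (intro mult_left_mono power_mono) auto
    also have "\<dots> = 2 * (1 + B * Suc k) ^ r" unfolding X1 Suc by simp
    finally have "card (sparse_ints b (Suc k) r) \<le> 2 * (1 + B * Suc k) ^ r" .
    moreover have "finite (sparse_ints b (Suc k) r)" unfolding set using fin by auto
    ultimately show ?thesis unfolding B_def by blast
  qed
qed

text \<open>The threshold \<open>1 / (2 * b)\<close> is chosen so that rounding commutes with multiplication by \<open>b\<close> at any
multiple of \<open>\<theta>\<close> that is nearer than this to an integer.\<close>

definition far_count :: "int \<Rightarrow> nat \<Rightarrow> real \<Rightarrow> nat" where
  "far_count b k \<theta> = card {j. j < k \<and> 1 / (2 * real_of_int b) \<le> \<bar>of_int b ^ j * \<theta> - of_int (round (of_int b ^ j * \<theta>))\<bar>}"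

lemma far_count_Suc:
  "far_count b (Suc k) \<theta> = far_count b k \<theta> +
    (if 1 / (2 * real_of_int b) \<le> \<bar>of_int b ^ k * \<theta> - of_int (round (of_int b ^ k * \<theta>))\<bar> then 1 else 0)"
proof -
  let ?P = "\<lambda>j. 1 / (2 * real_of_int b) \<le> \<bar>of_int b ^ j * \<theta> - of_int (round (of_int b ^ j * \<theta>))\<bar>"
  have "{j. j < Suc k \<and> ?P j} = (if ?P k then insert k {j. j < k \<and> ?P j} else {j. j < k \<and> ?P j})"
    by (auto simp: less_Suc_eq)
  then show ?thesis unfolding far_count_def by simp
qed

lemma round_in_sparse_ints:
  assumes b: "b > 0" and \<theta>: "0 \<le> \<theta>" "\<theta> \<le> 1" and r: "far_count b k \<theta> \<le> r"
  shows "round (of_int b ^ k * \<theta>) \<in> sparse_ints b k r"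
  using r
proof (induction k arbitrary: r)
  case 0
  have "round \<theta> \<ge> round (0::real)" "round \<theta> \<le> round (1::real)" using \<theta> by (intro round_mono; simp)+
  then show ?case by simp linarith
next
  case (Suc k)
  define x where "x = of_int b ^ k * \<theta>"
  define e where "e = x - of_int (round x)"
  have e: "\<bar>e\<bar> \<le> 1 / 2" using of_int_round_abs_le[of x] by (simp add: e_def abs_minus_commute)
  have bx: "of_int b ^ Suc k * \<theta> = of_int b * x" by (simp add: x_def)
  have be: "of_int b * x - of_int (b * round x) = of_int b * e" by (simp add: e_def algebra_simps)
  show ?case
  proof (cases "1 / (2 * real_of_int b) \<le> \<bar>e\<bar>")
    case False
    then have "\<bar>of_int b * e\<bar> < 1 / 2" using b by (simp add: abs_mult field_simps)
    then have "round (of_int b * x) = b * round x"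
      unfolding be[symmetric] by (rule round_unique')
    moreover have "round x \<in> sparse_ints b k r"
      using Suc False by (simp add: x_def e_def far_count_Suc)
    ultimately show ?thesis unfolding bx by (simp only: sparse_ints.simps Un_iff imageI simp_thms)
  next
    case True
    then have fc: "Suc (far_count b k \<theta>) \<le> r" using Suc.prems by (simp add: x_def e_def far_count_Suc)
    then obtain r' where r': "r = Suc r'" by (cases r) auto
    have mem: "round x \<in> sparse_ints b k r'" using Suc.IH[of r'] fc by (simp add: x_def r')
    define d where "d = round (of_int b * x) - b * round x"
    have "real_of_int d = (of_int (round (of_int b * x)) - of_int b * x) + of_int b * e"
      unfolding d_def be[symmetric] by simp
    moreover have "\<bar>of_int b * e\<bar> \<le> of_int b * (1 / 2)" using b e by (simp add: abs_mult field_simps)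
    ultimately have "\<bar>real_of_int d\<bar> \<le> 1 / 2 + of_int b * (1 / 2)"
      using of_int_round_abs_le[of "of_int b * x"] by linarith
    also have "\<dots> \<le> of_int b" using b by simp
    finally have "d \<in> {-b..b}" by auto
    moreover have "round (of_int b * x) = b * round x + d" by (simp add: d_def)
    ultimately show ?thesis using mem unfolding bx r' by auto
  qed
qed

text \<open>Distinct fractions with denominators at most \<open>Q\<close> differ by at least \<open>1 / Q\<^sup>2\<close>, so rounding after
multiplication by \<open>b ^ k\<close> separates them.  Fractions in lowest terms determine their denominators, and
the rounded values lie in the small set \<open>sparse_ints b k r\<close>.\<close>

lemma card_primes_with_sparse_fraction:
  fixes Q :: real
  assumes b: "b > 0" and Q: "Q\<^sup>2 < of_int b ^ k"
    and P: "\<And>p. p \<in> P \<Longrightarrow> prime p \<and> real p \<le> Q \<and> (\<exists>\<xi>. 0 < \<xi> \<and> \<xi> < p \<and> far_count b k (real \<xi> / real p) \<le> r)"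
  shows "card P \<le> 2 * (1 + nat (2 * b + 1) * k) ^ r"
proof -
  obtain \<xi> where \<xi>: "\<And>p. p \<in> P \<Longrightarrow> 0 < \<xi> p \<and> \<xi> p < p \<and> far_count b k (real (\<xi> p) / real p) \<le> r"
    using P by metis
  define v where "v p = round (of_int b ^ k * (real (\<xi> p) / real p))" for p
  have "inj_on v P"
  proof (rule inj_onI)
    fix p q assume p: "p \<in> P" and q: "q \<in> P" and eq: "v p = v q"
    have pos: "real p > 0" "real q > 0" using P[OF p] P[OF q] prime_gt_0_nat by auto
    have "\<bar>of_int b ^ k * (real (\<xi> p) / real p) - of_int b ^ k * (real (\<xi> q) / real q)\<bar> \<le> 1"
      using of_int_round_abs_le[of "of_int b ^ k * (real (\<xi> p) / real p)"]
        of_int_round_abs_le[of "of_int b ^ k * (real (\<xi> q) / real q)"] eq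
      unfolding v_def by linarith
    then have "\<bar>of_int b ^ k * (real (\<xi> p) / real p - real (\<xi> q) / real q)\<bar> \<le> 1"
      by (simp add: right_diff_distrib)
    moreover have "real (\<xi> p) / real p - real (\<xi> q) / real q = of_int (int (\<xi> p) * int q - int (\<xi> q) * int p) / (real p * real q)"
      using pos by (simp add: field_simps)
    ultimately have "of_int b ^ k * \<bar>of_int (int (\<xi> p) * int q - int (\<xi> q) * int p)\<bar> / (real p * real q) \<le> 1"
      using b pos by (simp only: abs_mult abs_divide) simp
    then have *: "of_int b ^ k * \<bar>of_int (int (\<xi> p) * int q - int (\<xi> q) * int p)\<bar> \<le> real p * real q"
      using pos by (simp add: divide_le_eq)
    also have "\<dots> \<le> Q * Q" using P[OF p] P[OF q] by (intro mult_mono) auto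
    also have "\<dots> < of_int b ^ k" using Q by (simp add: power2_eq_square)
    finally have "real_of_int \<bar>int (\<xi> p) * int q - int (\<xi> q) * int p\<bar> < 1"
      using b by (simp add: mult_less_cancel_left1)
    then have "int (\<xi> p) * int q = int (\<xi> q) * int p" by linarith
    then have "\<xi> p * q = \<xi> q * p" by (metis of_nat_eq_iff of_nat_mult)
    then have "p dvd \<xi> p * q" by simp
    then have "p dvd q" using P[OF p] \<xi>[OF p] prime_dvd_mult_iff[of p] nat_dvd_not_less by blast
    then show "p = q" using P[OF p] P[OF q] primes_dvd_imp_eq by blast
  qed
  moreover have "v ` P \<subseteq> sparse_ints b k r"
  proof
    fix y assume "y \<in> v ` P"
    then obtain p where p: "p \<in> P" "y = v p" by blast
    have "0 \<le> real (\<xi> p) / real p" "real (\<xi> p) / real p \<le> 1" using \<xi>[OF p(1)] by (auto simp: divide_le_eq)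
    then show "y \<in> sparse_ints b k r" unfolding p(2) v_def
      using \<xi>[OF p(1)] by (intro round_in_sparse_ints[OF b]) auto
  qed
  ultimately have "card P \<le> card (sparse_ints b k r)"
    using card_sparse_ints[OF b] card_inj_on_le by blast
  then show ?thesis using card_sparse_ints[OF b, of k r] by linarith
qed

lemma prod_power_bound_far_count:
  fixes g :: "real \<Rightarrow> real"
  assumes g: "\<And>\<theta>. 0 \<le> g \<theta>" "\<And>\<theta>. g \<theta> \<le> 1" "0 \<le> \<rho>"
    "\<And>\<theta>. 1 / (2 * real_of_int b) \<le> \<bar>\<theta> - of_int (round \<theta>)\<bar> \<Longrightarrow> g \<theta> \<le> \<rho>"
  shows "(\<Prod>j<k. g (of_int b ^ j * \<theta>)) \<le> \<rho> ^ far_count b k \<theta>"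
proof (induction k)
  case 0
  then show ?case by (simp add: far_count_def)
next
  case (Suc k)
  have "(\<Prod>j<Suc k. g (of_int b ^ j * \<theta>)) \<le> \<rho> ^ far_count b k \<theta> * g (of_int b ^ k * \<theta>)"
    using Suc g by (auto intro: mult_right_mono)
  also have "\<dots> \<le> \<rho> ^ far_count b (Suc k) \<theta>"
    using mult_left_mono[of "g (of_int b ^ k * \<theta>)" \<rho> "\<rho> ^ far_count b k \<theta>"]
      mult_left_mono[of "g (of_int b ^ k * \<theta>)" 1 "\<rho> ^ far_count b k \<theta>"] g
    by (auto simp: far_count_Suc mult.commute[of \<rho>])
  finally show ?case .
qed

section \<open>Sums over primes\<close>

text \<open>Split at \<open>T\<close>: the integers \<open>p \<le> T\<close> contribute at most
\<open>ln T\<close> times a harmonic sum, the others at most \<open>ln T / T\<close> each because \<open>ln x / x\<close> decreases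
beyond \<open>exp 1 < 3\<close>.\<close>

lemma sum_ln_over_le:
  fixes T :: nat
  assumes fin: "finite S" and pos: "\<And>p. p \<in> S \<Longrightarrow> p > 0" and T: "card S \<le> T" "3 \<le> T"
  shows "(\<Sum>p\<in>S. ln (real p) / real p) \<le> ln T * (2 + ln T)"
proof -
  have lnT: "ln T \<ge> 0" using T by simp
  have "(\<Sum>p\<in>{p\<in>S. p \<le> T}. ln (real p) / real p) \<le> (\<Sum>p\<in>{p\<in>S. p \<le> T}. ln T / real p)"
  proof (intro sum_mono divide_right_mono ln_mono)
    fix p assume "p \<in> {p\<in>S. p \<le> T}"
    then show "0 < real p" "real p \<le> real T" using pos by auto
  qed simp
  also have "\<dots> \<le> (\<Sum>p\<in>{1..T}. ln T / real p)"
    using pos lnT by (intro sum_mono2) (auto simp: Suc_le_eq)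
  also have "\<dots> = ln T * harm T" by (simp add: harm_def sum_distrib_left divide_inverse)
  also have "\<dots> \<le> ln T * (1 + ln T)"
    using euler_mascheroni_sequence_decreasing[of 1 T] T(2) by (intro mult_left_mono lnT) (simp add: harm_expand)
  finally have 1: "(\<Sum>p\<in>{p\<in>S. p \<le> T}. ln (real p) / real p) \<le> ln T * (1 + ln T)" .
  have "(\<Sum>p\<in>{p\<in>S. \<not> p \<le> T}. ln (real p) / real p) \<le> (\<Sum>p\<in>{p\<in>S. \<not> p \<le> T}. ln T / T)"
  proof (rule sum_mono)
    fix p assume "p \<in> {p\<in>S. \<not> p \<le> T}"
    moreover have "exp 1 \<le> real T" using T(2) exp_le by linarith
    ultimately show "ln (real p) / real p \<le> ln T / T" by (intro ln_x_over_x_mono) auto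
  qed
  also have "\<dots> = card {p\<in>S. \<not> p \<le> T} * (ln T / T)" by simp
  also have "\<dots> \<le> T * (ln T / T)"
    using card_mono[of S "{p\<in>S. \<not> p \<le> T}"] fin T lnT by (intro mult_right_mono) auto
  also have "\<dots> = ln T" using T by simp
  finally have 2: "(\<Sum>p\<in>{p\<in>S. \<not> p \<le> T}. ln (real p) / real p) \<le> ln T" .
  have "(\<Sum>p\<in>S. ln (real p) / real p) = (\<Sum>p\<in>{p\<in>S. p \<le> T}. ln (real p) / real p) + (\<Sum>p\<in>{p\<in>S. \<not> p \<le> T}. ln (real p) / real p)"
    using fin by (subst sum.union_disjoint[symmetric]) (auto intro: sum.cong)
  then show ?thesis using 1 2 by (simp add: algebra_simps)
qed

lemma sum_ln_prime_divisors_le: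
  fixes m :: int
  assumes fin: "finite S" and S: "\<And>p. p \<in> S \<Longrightarrow> prime p \<and> int p dvd m" and m: "m \<noteq> 0"
  shows "(\<Sum>p\<in>S. ln (real p)) \<le> ln \<bar>real_of_int m\<bar>"
proof -
  have "(\<Prod>p\<in>S. int p) dvd m" using fin S
  proof (induction S rule: finite_induct)
    case (insert p S)
    have "coprime (int p) (\<Prod>q\<in>S. int q)"
      using insert by (intro prod_coprime_right) (auto intro!: primes_coprime)
    then show ?case using insert by (simp add: divides_mult)
  qed simp
  then have "(\<Prod>p\<in>S. int p) \<le> \<bar>m\<bar>" using m by (intro zdvd_imp_le) auto
  then have "int (\<Prod>S) \<le> \<bar>m\<bar>" by simp
  then have "real (\<Prod>S) \<le> \<bar>real_of_int m\<bar>" by linarith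
  moreover have "real (\<Prod>S) > 0" using S fin prime_gt_0_nat by (auto intro!: prod_pos)
  ultimately have "ln (real (\<Prod>S)) \<le> ln \<bar>real_of_int m\<bar>" by (intro ln_mono)
  moreover have "ln (real (\<Prod>S)) = (\<Sum>p\<in>S. ln (real p))"
    using S prime_gt_0_nat fin by (subst of_nat_prod, subst ln_prod) fastforce+
  ultimately show ?thesis by simp
qed

text \<open>Gallagher's larger sieve in averaged form: weight each pair of distinct points of \<open>E\<close> by the total
logarithm of the primes dividing their difference, and exchange the sums over pairs and primes.\<close>

lemma larger_sieve:
  fixes f :: "int \<Rightarrow> real" and D s :: real
  assumes fin: "finite E" "finite S" and f: "\<And>x. x \<in> E \<Longrightarrow> f x \<ge> 0" "(\<Sum>x\<in>E. f x) \<le> 1"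
    and D: "\<And>x y. x \<in> E \<Longrightarrow> y \<in> E \<Longrightarrow> real_of_int \<bar>x - y\<bar> \<le> D" "D \<ge> 1"
    and S: "\<And>p. p \<in> S \<Longrightarrow> prime p"
    and coll: "\<And>p. p \<in> S \<Longrightarrow> s / real p \<le> (\<Sum>x\<in>E. \<Sum>y\<in>E. f x * f y * (if int p dvd x - y \<and> x \<noteq> y then 1 else 0))"
  shows "s * (\<Sum>p\<in>S. ln (real p) / real p) \<le> ln D"
proof -
  have "s * (\<Sum>p\<in>S. ln (real p) / real p) = (\<Sum>p\<in>S. ln (real p) * (s / real p))"
    by (simp add: sum_distrib_left mult_ac)
  also have "\<dots> \<le> (\<Sum>p\<in>S. ln (real p) * (\<Sum>x\<in>E. \<Sum>y\<in>E. f x * f y * (if int p dvd x - y \<and> x \<noteq> y then 1 else 0)))"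
    using coll S prime_ge_1_nat by (intro sum_mono mult_left_mono) (auto intro!: ln_ge_zero)
  also have "\<dots> = (\<Sum>x\<in>E. \<Sum>y\<in>E. f x * f y * (\<Sum>p\<in>S. ln (real p) * (if int p dvd x - y \<and> x \<noteq> y then 1 else 0)))"
    unfolding sum_distrib_left
    by (subst sum.swap, rule sum.cong[OF refl], subst sum.swap) (simp add: mult_ac)
  also have "\<dots> \<le> (\<Sum>x\<in>E. \<Sum>y\<in>E. f x * f y * ln D)"
  proof (intro sum_mono mult_left_mono)
    fix x y assume xy: "x \<in> E" "y \<in> E"
    show "(\<Sum>p\<in>S. ln (real p) * (if int p dvd x - y \<and> x \<noteq> y then 1 else 0)) \<le> ln D"
    proof (cases "x = y")
      case True
      then show ?thesis using D(2) by simp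
    next
      case False
      have "(\<Sum>p\<in>S. ln (real p) * (if int p dvd x - y \<and> x \<noteq> y then 1 else 0)) = (\<Sum>p\<in>{p\<in>S. int p dvd x - y}. ln (real p))"
        using False fin by (subst sum.inter_filter) (auto intro!: sum.cong)
      also have "\<dots> \<le> ln \<bar>real_of_int (x - y)\<bar>"
        using False fin S by (intro sum_ln_prime_divisors_le) auto
      also have "\<dots> \<le> ln D" using D(1)[OF xy] False by (intro ln_mono) auto
      finally show ?thesis .
    qed
    show "0 \<le> f x * f y" using f xy by simp
  qed
  also have "\<dots> = (\<Sum>x\<in>E. f x)\<^sup>2 * ln D"
    by (simp add: power2_eq_square sum_product flip: sum_distrib_right)
  also have "\<dots> \<le> 1 * ln D"
    using f D(2) sum_nonneg[of E f] by (intro mult_right_mono power_le_one) auto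
  finally show ?thesis by simp
qed

section \<open>Equidistribution of the random sum modulo a prime\<close>

lemma mu_seq_block_decomposition:
  fixes a :: int and \<mu> :: "int pmf" and L g N r :: nat
  defines "b \<equiv> a ^ (L + g)"
  defines "\<nu> \<equiv> mu_seq b (mu_seq a \<mu> L) N"
  shows "mu_seq a \<mu> ((L + g) * (2 * N) + r) = conv_pmf \<nu> (conv_pmf (map_pmf ((*) (b ^ N)) \<nu>)
    (conv_pmf (mu_seq b (map_pmf ((*) (a ^ L)) (mu_seq a \<mu> g)) (2 * N))
       (map_pmf ((*) (b ^ (2 * N))) (mu_seq a \<mu> r))))"
proof -
  have "mu_seq b (mu_seq a \<mu> L) (2 * N) = conv_pmf \<nu> (map_pmf ((*) (b ^ N)) \<nu>)"
    unfolding \<nu>_def mult_2 by (rule mu_seq_add)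
  then show ?thesis
    unfolding mu_seq_add[of a \<mu> "(L + g) * (2 * N)"] mu_seq_mult[of a \<mu> "L + g" "2 * N"]
      mu_seq_add[of a \<mu> L g] mu_seq_conv power_mult b_def[symmetric]
    by (simp only: conv_pmf_assoc)
qed

lemma pmf_map_eq_expectation:
  "pmf (map_pmf f \<rho>) t = measure_pmf.expectation \<rho> (\<lambda>x. if f x = t then 1 else (0::real))"
proof -
  have "pmf (map_pmf f \<rho>) t = measure_pmf.expectation \<rho> (indicat_real (f -` {t}))"
    by (simp add: pmf_map)
  also have "indicat_real (f -` {t}) = (\<lambda>x. if f x = t then 1 else 0)"
    by (auto simp: indicator_def)
  finally show ?thesis .
qed

lemma pmf_mod_conv3_ge:
  assumes fin: "finite (set_pmf \<nu>)" "finite (set_pmf Z)" and E: "E \<subseteq> set_pmf \<nu>" and t: "t \<in> {0..<int p}"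
  shows "(\<Sum>x\<in>E. \<Sum>y\<in>E. \<Sum>z\<in>set_pmf Z. pmf \<nu> x * pmf \<nu> y * pmf Z z * (if int p dvd x + M * y + z - t then 1 else 0))
    \<le> pmf (mod_pmf (conv_pmf \<nu> (conv_pmf (map_pmf ((*) M) \<nu>) Z)) p) t"
proof -
  have fin': "finite (set_pmf (map_pmf ((*) M) \<nu>))" "finite (set_pmf (conv_pmf (map_pmf ((*) M) \<nu>) Z))"
    using fin by (auto simp: set_conv_pmf)
  have m: "w mod int p = t \<longleftrightarrow> int p dvd w - t" for w
    using t by (metis atLeastLessThan_iff mod_eq_dvd_iff mod_pos_pos_trivial)
  have "pmf (mod_pmf (conv_pmf \<nu> (conv_pmf (map_pmf ((*) M) \<nu>) Z)) p) t =
    (\<Sum>x\<in>set_pmf \<nu>. \<Sum>y\<in>set_pmf \<nu>. \<Sum>z\<in>set_pmf Z. pmf \<nu> x * pmf \<nu> y * pmf Z z * (if int p dvd x + M * y + z - t then 1 else 0))"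
    unfolding mod_pmf_def pmf_map_eq_expectation expectation_conv_pmf[OF fin(1) fin'(2)]
      expectation_conv_pmf[OF fin'(1) fin(2)] integral_map_pmf
      expectation_finite_pmf[OF fin(1)] expectation_finite_pmf[OF fin(2)] m real_scaleR_def sum_distrib_left
    by (intro sum.cong refl) (simp add: add.assoc)
  moreover have "(\<Sum>x\<in>E. \<Sum>y\<in>E. \<Sum>z\<in>set_pmf Z. pmf \<nu> x * pmf \<nu> y * pmf Z z * (if int p dvd x + M * y + z - t then 1 else 0))
    \<le> (\<Sum>x\<in>E. \<Sum>y\<in>set_pmf \<nu>. \<Sum>z\<in>set_pmf Z. pmf \<nu> x * pmf \<nu> y * pmf Z z * (if int p dvd x + M * y + z - t then 1 else 0))"
    by (intro sum_mono sum_mono2 fin E sum_nonneg) auto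
  moreover have "\<dots> \<le> (\<Sum>x\<in>set_pmf \<nu>. \<Sum>y\<in>set_pmf \<nu>. \<Sum>z\<in>set_pmf Z. pmf \<nu> x * pmf \<nu> y * pmf Z z * (if int p dvd x + M * y + z - t then 1 else 0))"
    by (intro sum_mono2 fin E sum_nonneg) auto
  ultimately show ?thesis by linarith
qed

text \<open>A one-sided bound suffices, because both measures have mass \<open>1\<close> and hence the positive and the
negative part of their difference have the same norm.\<close>

lemma l1_norm_mod_le:
  assumes p: "p > 0" and \<delta>: "\<delta> \<ge> 0" and lower: "\<And>t. t \<in> {0..<int p} \<Longrightarrow> (1 - \<delta>) / p \<le> pmf (mod_pmf \<rho> p) t"
  shows "l1_norm_mod p (\<lambda>x. pmf (mod_pmf \<rho> p) x - pmf (unif_mod p) x) \<le> 2 * \<delta>"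
proof -
  let ?q = "pmf (mod_pmf \<rho> p)"
  have u: "pmf (unif_mod p) t = 1 / p" if "t \<in> {0..<int p}" for t
    using that p by (simp add: unif_mod_def)
  have q1: "(\<Sum>t\<in>{0..<int p}. ?q t) = 1"
    by (rule sum_pmf_eq_1) (use p in \<open>auto simp: mod_pmf_def\<close>)
  have "l1_norm_mod p (\<lambda>x. ?q x - pmf (unif_mod p) x) \<le> (\<Sum>t\<in>{0..<int p}. (?q t - 1 / p) + 2 * (\<delta> / p))"
    unfolding l1_norm_mod_def
  proof (rule sum_mono)
    fix t assume t: "t \<in> {0..<int p}"
    have "?q t - 1 / p \<ge> - (\<delta> / p)" using lower[OF t] by (simp add: diff_divide_distrib)
    moreover have "\<delta> / p \<ge> 0" using \<delta> by simp
    ultimately show "\<bar>?q t - pmf (unif_mod p) t\<bar> \<le> (?q t - 1 / p) + 2 * (\<delta> / p)"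
      unfolding u[OF t] by linarith
  qed
  also have "\<dots> = 2 * \<delta>" using p by (simp add: sum.distrib sum_subtractf q1)
  finally show ?thesis .
qed

lemma l1_norm_mod_conv3_le:
  fixes p :: nat and M :: int and c \<kappa> \<eta> :: real
  assumes fin: "finite (set_pmf \<nu>)" "finite (set_pmf Z)" and E: "E \<subseteq> set_pmf \<nu>"
    and p: "p > 0" and cop: "coprime (int p) M"
    and mass: "(\<Sum>x\<in>E. pmf \<nu> x) \<ge> 1 - \<eta>" and \<eta>: "0 \<le> \<eta>" "\<eta> \<le> 1"
    and coll: "(\<Sum>x\<in>E. \<Sum>y\<in>E. pmf \<nu> x * pmf \<nu> y * (if int p dvd x - y then 1 else 0)) \<le> c / p" and c0: "c \<ge> 0"
    and small: "\<And>\<xi>. 0 < \<xi> \<Longrightarrow> \<xi> < p \<Longrightarrow> norm (charfn Z (real \<xi> / real p)) \<le> \<kappa>" and k0: "\<kappa> \<ge> 0"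
  shows "l1_norm_mod p (\<lambda>x. pmf (mod_pmf (conv_pmf \<nu> (conv_pmf (map_pmf ((*) M) \<nu>) Z)) p) x - pmf (unif_mod p) x)
    \<le> 2 * (2 * \<eta> + c * \<kappa>)"
proof (rule l1_norm_mod_le[OF p])
  show "0 \<le> 2 * \<eta> + c * \<kappa>" using \<eta> c0 k0 by simp
  fix t assume t: "t \<in> {0..<int p}"
  let ?w = "\<Sum>x\<in>E. pmf \<nu> x"
  have "(1 - \<eta>)\<^sup>2 \<le> ?w\<^sup>2" using mass \<eta> by (intro power_mono) auto
  moreover have "(1 - \<eta>)\<^sup>2 \<ge> 1 - 2 * \<eta>" by (simp add: power2_eq_square algebra_simps)
  ultimately have "(1 - (2 * \<eta> + c * \<kappa>)) / p \<le> (?w\<^sup>2 - c * \<kappa>) / p"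
    by (intro divide_right_mono) auto
  also have "\<dots> \<le> (\<Sum>x\<in>E. \<Sum>y\<in>E. \<Sum>z\<in>set_pmf Z. pmf \<nu> x * pmf \<nu> y * pmf Z z * (if int p dvd x + M * y + z - t then 1 else 0))"
    using finite_subset[OF E fin(1)] fin(2) p cop sum_pmf_eq_1[OF fin(2) order_refl] coll small k0
    by (intro equidistribution_lower_bound) (auto simp: charfn_eq_exp_sum)
  also have "\<dots> \<le> pmf (mod_pmf (conv_pmf \<nu> (conv_pmf (map_pmf ((*) M) \<nu>) Z)) p) t"
    by (rule pmf_mod_conv3_ge[OF fin E t])
  finally show "(1 - (2 * \<eta> + c * \<kappa>)) / p \<le> pmf (mod_pmf (conv_pmf \<nu> (conv_pmf (map_pmf ((*) M) \<nu>) Z)) p) t" .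
qed

text \<open>Independent summands can only decrease the absolute value, so of each block of \<open>g\<close> digits it is enough
to keep the lowest one.\<close>

lemma norm_charfn_spread_le:
  assumes fin: "finite (set_pmf \<mu>)" "finite (set_pmf \<omega>)" and g: "g > 0"
  shows "norm (charfn (conv_pmf (mu_seq b (map_pmf ((*) d) (mu_seq a \<mu> g)) k) \<omega>) \<theta>)
    \<le> (\<Prod>j<k. norm (charfn \<mu> (of_int b ^ j * (of_int d * \<theta>))))"
proof -
  note fin' = finite_mu_seq[OF fin(1)]
  obtain g' where g': "g = Suc g'" using g gr0_implies_Suc by blast
  have step: "norm (charfn (mu_seq a \<mu> g) \<psi>) \<le> norm (charfn \<mu> \<psi>)" for \<psi>
    unfolding g' using fin fin' by (simp add: charfn_conv norm_mult mult_left_le norm_charfn_le_1)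
  have "norm (charfn (conv_pmf (mu_seq b (map_pmf ((*) d) (mu_seq a \<mu> g)) k) \<omega>) \<theta>)
     \<le> norm (charfn (mu_seq b (map_pmf ((*) d) (mu_seq a \<mu> g)) k) \<theta>)"
    using fin(2) fin' by (subst charfn_conv) (auto intro!: finite_mu_seq simp: norm_mult mult_left_le norm_charfn_le_1)
  also have "\<dots> = (\<Prod>j<k. norm (charfn (mu_seq a \<mu> g) (of_int b ^ j * (of_int d * \<theta>))))"
    using fin' by (subst charfn_mu_seq) (auto simp: charfn_map_mult prod_norm mult_ac)
  also have "\<dots> \<le> (\<Prod>j<k. norm (charfn \<mu> (of_int b ^ j * (of_int d * \<theta>))))"
    by (intro prod_mono) (auto simp: step)
  finally show ?thesis .
qed

text \<open>Multiplication by \<open>d\<close> permutes the nonzero frequencies modulo \<open>p\<close>, and each index \<open>j\<close> for which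
\<open>b ^ j * \<xi>' / p\<close> is far from the integers costs a factor \<open>\<rho>\<close>.\<close>

lemma sparse_fraction_of_large_product:
  fixes \<kappa> \<rho> :: real and p \<xi> k :: nat and d b :: int
  assumes p: "prime p" "\<not> int p dvd d" and \<xi>: "0 < \<xi>" "\<xi> < p"
    and \<rho>: "0 \<le> \<rho>" "\<And>\<theta>. 1 / (2 * real_of_int b) \<le> \<bar>\<theta> - of_int (round \<theta>)\<bar> \<Longrightarrow> norm (charfn \<mu> \<theta>) \<le> \<rho>"
    and large: "\<kappa> < (\<Prod>j<k. norm (charfn \<mu> (of_int b ^ j * (of_int d * (real \<xi> / real p)))))"
  shows "\<exists>\<xi>'. 0 < \<xi>' \<and> \<xi>' < p \<and> \<kappa> < \<rho> ^ far_count b k (real \<xi>' / real p)"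
proof -
  define m where "m = (d * int \<xi>) mod int p"
  have p0: "p > 0" using p(1) prime_gt_0_nat by blast
  have "\<not> int p dvd d * int \<xi>"
    using p \<xi> by (auto simp: prime_dvd_mult_iff dest: nat_dvd_not_less)
  then have "m \<noteq> 0" by (simp add: m_def mod_eq_0_iff_dvd)
  moreover have "0 \<le> m" "m < int p" using p0 by (simp_all add: m_def)
  ultimately have m: "0 < m" "m < int p" by simp_all
  have "real_of_int (d * int \<xi>) = real_of_int (int p * ((d * int \<xi>) div int p) + m)"
    by (simp only: m_def mult_div_mod_eq)
  then have frac: "of_int d * (real \<xi> / real p) = real (nat m) / real p + of_int ((d * int \<xi>) div int p)"
    using p0 m by (simp add: field_simps)
  have "charfn \<mu> (of_int b ^ j * (of_int d * (real \<xi> / real p))) = charfn \<mu> (of_int b ^ j * (real (nat m) / real p))" for j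
    using charfn_add_int[of \<mu> "of_int b ^ j * (real (nat m) / real p)" "b ^ j * ((d * int \<xi>) div int p)"]
    unfolding frac by (simp add: distrib_left)
  then have "\<kappa> < (\<Prod>j<k. norm (charfn \<mu> (of_int b ^ j * (real (nat m) / real p))))" using large by simp
  also have "\<dots> \<le> \<rho> ^ far_count b k (real (nat m) / real p)"
    using \<rho> by (intro prod_power_bound_far_count) (auto simp: norm_charfn_le_1)
  finally show ?thesis using m by (intro exI[of _ "nat m"]) auto
qed


text \<open>The diagonal of the collision sum is at most the largest value of \<open>\<nu>\<close> on \<open>E\<close>.\<close>

lemma collision_sum_le:
  fixes p :: nat
  assumes fin: "finite E" and mass: "(\<Sum>x\<in>E. pmf \<nu> x) \<le> 1" and le: "\<And>x. x \<in> E \<Longrightarrow> pmf \<nu> x \<le> 1 / real p"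
  shows "(\<Sum>x\<in>E. \<Sum>y\<in>E. pmf \<nu> x * pmf \<nu> y * (if int p dvd x - y then 1 else 0)) \<le>
    (\<Sum>x\<in>E. \<Sum>y\<in>E. pmf \<nu> x * pmf \<nu> y * (if int p dvd x - y \<and> x \<noteq> y then 1 else 0)) + 1 / real p"
proof -
  have "(\<Sum>x\<in>E. pmf \<nu> x * pmf \<nu> x) \<le> (\<Sum>x\<in>E. pmf \<nu> x * (1 / real p))"
    using le by (intro sum_mono mult_left_mono) auto
  also have "\<dots> \<le> 1 * (1 / real p)"
    unfolding sum_distrib_right[symmetric] using mass by (intro mult_right_mono) auto
  finally have diag: "(\<Sum>x\<in>E. pmf \<nu> x * pmf \<nu> x) \<le> 1 / real p" by simp
  have "(\<Sum>x\<in>E. \<Sum>y\<in>E. pmf \<nu> x * pmf \<nu> y * (if int p dvd x - y then 1 else 0))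
    = (\<Sum>x\<in>E. \<Sum>y\<in>E. pmf \<nu> x * pmf \<nu> y * (if int p dvd x - y \<and> x \<noteq> y then 1 else 0)
        + (if x = y then pmf \<nu> x * pmf \<nu> y else 0))"
    by (intro sum.cong refl) auto
  also have "\<dots> = (\<Sum>x\<in>E. \<Sum>y\<in>E. pmf \<nu> x * pmf \<nu> y * (if int p dvd x - y \<and> x \<noteq> y then 1 else 0))
      + (\<Sum>x\<in>E. pmf \<nu> x * pmf \<nu> x)"
    unfolding sum.distrib using fin by (simp add: sum.delta)
  finally show ?thesis using diag by simp
qed

text \<open>Here \<open>2 * \<Lambda> / p\<close> is the bound on the collision probability.  With \<open>\<kappa> = \<epsilon> / (16 * \<Lambda>)\<close> and the
exceptional mass \<open>\<epsilon> / 16\<close>, the bound of \<open>l1_norm_mod_conv3_le\<close> is \<open>\<epsilon> / 2\<close>; so if \<open>\<mu>\<^sub>n mod p\<close> is not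
close to uniform, the factor
\<open>Z\<close> has a characteristic function larger than \<open>\<kappa>\<close> at some nonzero frequency.\<close>

lemma sparse_fraction_of_bad_prime:
  fixes a :: int and \<mu> :: "int pmf" and L g N r p :: nat and \<epsilon> \<rho> \<Lambda> :: real
  defines "b \<equiv> a ^ (L + g)"
  defines "\<nu> \<equiv> mu_seq b (mu_seq a \<mu> L) N"
  assumes fin: "finite (set_pmf \<mu>)" and g: "g > 0" and \<epsilon>: "0 < \<epsilon>" "\<epsilon> \<le> 1" and \<Lambda>: "\<Lambda> > 0"
    and p: "prime p" "\<not> int p dvd a"
    and E: "E \<subseteq> set_pmf \<nu>" "1 - \<epsilon> / 16 \<le> (\<Sum>x\<in>E. pmf \<nu> x)"
    and coll: "(\<Sum>x\<in>E. \<Sum>y\<in>E. pmf \<nu> x * pmf \<nu> y * (if int p dvd x - y then 1 else 0)) \<le> 2 * \<Lambda> / p"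
    and \<rho>: "0 \<le> \<rho>" "\<And>\<theta>. 1 / (2 * real_of_int b) \<le> \<bar>\<theta> - of_int (round \<theta>)\<bar> \<Longrightarrow> norm (charfn \<mu> \<theta>) \<le> \<rho>"
    and bad: "\<epsilon> \<le> l1_norm_mod p (\<lambda>x. pmf (mod_pmf (mu_seq a \<mu> ((L + g) * (2 * N) + r)) p) x - pmf (unif_mod p) x)"
  shows "\<exists>\<xi>. 0 < \<xi> \<and> \<xi> < p \<and> \<epsilon> / (16 * \<Lambda>) < \<rho> ^ far_count b (2 * N) (real \<xi> / real p)"
proof -
  define \<kappa> where "\<kappa> = \<epsilon> / (16 * \<Lambda>)"
  have \<kappa>: "\<kappa> > 0" using \<epsilon> \<Lambda> by (simp add: \<kappa>_def)
  note fin' = finite_mu_seq[OF fin]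
  define Z where "Z = conv_pmf (mu_seq b (map_pmf ((*) (a ^ L)) (mu_seq a \<mu> g)) (2 * N)) (map_pmf ((*) (b ^ (2 * N))) (mu_seq a \<mu> r))"
  have dec: "mu_seq a \<mu> ((L + g) * (2 * N) + r) = conv_pmf \<nu> (conv_pmf (map_pmf ((*) (b ^ N)) \<nu>) Z)"
    unfolding \<nu>_def Z_def b_def by (rule mu_seq_block_decomposition)
  have fin\<nu>: "finite (set_pmf \<nu>)" unfolding \<nu>_def by (intro finite_mu_seq fin)
  have finZ: "finite (set_pmf Z)" unfolding Z_def set_conv_pmf
    by (intro finite_imageI finite_cartesian_product finite_mu_seq) (simp_all add: fin')
  have Zbound: "norm (charfn Z \<theta>) \<le> (\<Prod>j<2 * N. norm (charfn \<mu> (of_int b ^ j * (of_int (a ^ L) * \<theta>))))" for \<theta>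
    unfolding Z_def using fin' by (intro norm_charfn_spread_le[OF fin _ g]) simp
  have prime_p: "prime (int p)" using p(1) by simp
  then have ndvd: "\<not> int p dvd a ^ k" for k
    using p(2) prime_dvd_power[of "int p" a k] by blast
  have cop: "coprime (int p) (a ^ k)" for k
    by (rule prime_imp_coprime[OF prime_p ndvd])
  have "\<exists>\<xi>. 0 < \<xi> \<and> \<xi> < p \<and> \<kappa> < norm (charfn Z (real \<xi> / real p))"
  proof (rule ccontr)
    assume "\<not> ?thesis"
    then have "norm (charfn Z (real \<xi> / real p)) \<le> \<kappa>" if "0 < \<xi>" "\<xi> < p" for \<xi> :: nat
      using that by (meson not_le)
    moreover have "coprime (int p) (b ^ N)" unfolding b_def power_mult[symmetric] by (rule cop)
    ultimately have "l1_norm_mod p (\<lambda>x. pmf (mod_pmf (mu_seq a \<mu> ((L + g) * (2 * N) + r)) p) x - pmf (unif_mod p) x)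
        \<le> 2 * (2 * (\<epsilon> / 16) + (2 * \<Lambda>) * \<kappa>)"
      unfolding dec using fin\<nu> finZ E prime_gt_0_nat[OF p(1)] coll \<epsilon> \<kappa> \<Lambda>
      by (intro l1_norm_mod_conv3_le) auto
    also have "\<dots> = \<epsilon> / 2" using \<Lambda> by (simp add: \<kappa>_def)
    finally show False using bad \<epsilon> by simp
  qed
  then obtain \<xi> where \<xi>: "0 < \<xi>" "\<xi> < p" "\<kappa> < norm (charfn Z (real \<xi> / real p))" by blast
  then show ?thesis
    using sparse_fraction_of_large_product[OF p(1) ndvd \<xi>(1,2) \<rho> less_le_trans[OF \<xi>(3) Zbound]]
    by (simp add: \<kappa>_def)
qed

section \<open>Asymptotics and conclusion\<close>

lemma le_floor_of_less_power:
  fixes \<kappa> \<rho> :: real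
  assumes "0 < \<kappa>" "0 < \<rho>" "\<rho> < 1" "\<kappa> < \<rho> ^ m"
  shows "m \<le> nat \<lfloor>ln (1 / \<kappa>) / ln (1 / \<rho>)\<rfloor>"
proof -
  have "ln (1 / \<rho>) > 0" using assms by (simp add: ln_div)
  moreover have "ln \<kappa> < ln (\<rho> ^ m)" using assms by (intro ln_strict_mono) auto
  then have "m * ln (1 / \<rho>) \<le> ln (1 / \<kappa>)" using assms by (simp add: ln_realpow ln_div)
  ultimately have "real m \<le> ln (1 / \<kappa>) / ln (1 / \<rho>)" by (simp add: pos_le_divide_eq)
  then show ?thesis by linarith
qed


lemma polylog_le_sqrt:
  fixes \<alpha> \<beta> c :: real
  assumes "c > 0" "\<beta> > 0"
  shows "\<exists>K. \<forall>\<^sub>F n::nat in sequentially.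
    (ln 3 + (\<alpha> + \<beta> * ln n) * ln (1 + c * n)) * (2 + (ln 3 + (\<alpha> + \<beta> * ln n) * ln (1 + c * n))) \<le> K * sqrt n"
proof -
  have "(\<lambda>n::nat. (ln 3 + (\<alpha> + \<beta> * ln n) * ln (1 + c * n)) * (2 + (ln 3 + (\<alpha> + \<beta> * ln n) * ln (1 + c * n)))) \<in> O(\<lambda>n. sqrt n)"
    using assms by real_asymp
  then obtain K where "\<forall>\<^sub>F n::nat in sequentially.
    norm ((ln 3 + (\<alpha> + \<beta> * ln n) * ln (1 + c * n)) * (2 + (ln 3 + (\<alpha> + \<beta> * ln n) * ln (1 + c * n)))) \<le> K * norm (sqrt n)"
    by (auto elim!: landau_o.bigE)
  then have "\<forall>\<^sub>F n::nat in sequentially.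
    (ln 3 + (\<alpha> + \<beta> * ln n) * ln (1 + c * n)) * (2 + (ln 3 + (\<alpha> + \<beta> * ln n) * ln (1 + c * n))) \<le> K * sqrt n"
    by eventually_elim simp
  then show ?thesis by blast
qed

lemma sqrt_bound_from_eventual:
  fixes f :: "nat \<Rightarrow> real"
  assumes "\<forall>\<^sub>F n in sequentially. f n \<le> K * sqrt n"
  shows "\<exists>K. \<forall>n\<ge>1. f n \<le> K * sqrt n"
proof -
  obtain n0 where n0: "\<And>n. n \<ge> n0 \<Longrightarrow> f n \<le> K * sqrt n" using assms by (auto simp: eventually_sequentially)
  show ?thesis
  proof (intro exI allI impI)
    fix n :: nat assume n: "n \<ge> 1"
    have s: "sqrt n \<ge> 1" using n by simp
    have nn: "(\<Sum>i<n0. \<bar>f i\<bar>) \<ge> 0" by (simp add: sum_nonneg)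
    show "f n \<le> (\<bar>K\<bar> + (\<Sum>i<n0. \<bar>f i\<bar>)) * sqrt n"
    proof (cases "n < n0")
      case True
      have "f n \<le> \<bar>f n\<bar>" by simp
      also have "\<dots> \<le> (\<Sum>i<n0. \<bar>f i\<bar>)" using True by (intro member_le_sum) auto
      also have "\<dots> \<le> (\<bar>K\<bar> + (\<Sum>i<n0. \<bar>f i\<bar>)) * 1" by simp
      also have "\<dots> \<le> (\<bar>K\<bar> + (\<Sum>i<n0. \<bar>f i\<bar>)) * sqrt n" using s nn by (intro mult_left_mono) auto
      finally show ?thesis .
    next
      case False
      then have "f n \<le> K * sqrt n" using n0 by simp
      also have "\<dots> \<le> (\<bar>K\<bar> + (\<Sum>i<n0. \<bar>f i\<bar>)) * sqrt n" using s nn by (intro mult_right_mono) linarith+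
      finally show ?thesis .
    qed
  qed
qed

text \<open>The bad primes are divided into the divisors of \<open>a\<close>, those with a large collision probability, and
those with a sparse fraction.  The parameters are chosen in this order: \<open>g\<close> makes the blocks decodable,
\<open>L\<close> makes the gaps of length \<open>g\<close> negligible, and \<open>h\<close> lies strictly between the entropy
\<open>(1 - 2 * \<epsilon>) * s * H\<close> that a copy of \<open>\<nu>\<close> needs per block and the entropy \<open>H * L\<close> available.\<close>

lemma bad_primes_sum_bound:
  fixes a :: int and \<mu> :: "int pmf" and \<epsilon> :: real
  assumes a: "a > 1" and fin: "finite (set_pmf \<mu>)"
    and gcd: "Gcd {x - y | x y. x \<in> set_pmf \<mu> \<and> y \<in> set_pmf \<mu>} = 1"
    and \<epsilon>: "0 < \<epsilon>" "\<epsilon> < 1 / 2" and Hpos: "asymp_entropy a \<mu> > 0"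
  shows "\<exists>K. \<forall>\<^sub>F n in sequentially. (\<Sum>p\<in>bad_primes a \<mu> \<epsilon> n. ln (real p) / real p) \<le> K * sqrt (real n)"
proof -
  define H where "H = asymp_entropy a \<mu>"
  have H: "0 < H" "H \<le> ln (real_of_int a)" "\<And>n. H * real n \<le> pmf_entropy (mu_seq a \<mu> n)"
    using Hpos asymp_entropy_le_ln[OF a fin] asymp_entropy_le[OF a fin] by (simp_all add: H_def)
  define B where "B = Max (abs ` set_pmf \<mu>)"
  have B: "\<bar>x\<bar> \<le> B" if "x \<in> set_pmf \<mu>" for x
    unfolding B_def using fin that by (intro Max_ge) auto
  have B0: "B \<ge> 0" using B set_pmf_not_empty[of \<mu>] by fastforce
  obtain g0 :: nat where "real_of_int (2 * B) < real_of_int a ^ g0"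
    using real_arch_pow[of "real_of_int a"] a by auto
  moreover have "real_of_int a ^ g0 \<le> real_of_int a ^ Suc g0" using a by (intro power_increasing) auto
  ultimately have "real_of_int (2 * B) < real_of_int (a ^ Suc g0)" unfolding of_int_power by linarith
  then obtain g where g: "2 * B < a ^ g" "g > 0" unfolding of_int_less_iff by blast
  obtain L :: nat where L: "g / (2 * \<epsilon>) < L" using reals_Archimedean2 by blast
  then have L': "real g < 2 * \<epsilon> * L" using \<epsilon> by (simp add: field_simps)
  define s where "s = L + g"
  have s: "s > 0" using g by (simp add: s_def)
  define b where "b = a ^ s"
  have b: "b > 1" using a s by (simp add: b_def)
  define \<sigma> where "\<sigma> = mu_seq a \<mu> L"
  have fin\<sigma>: "finite (set_pmf \<sigma>)" unfolding \<sigma>_def by (rule finite_mu_seq[OF fin])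
  have suppl: "\<bar>y\<bar> \<le> B * (a ^ L - 1)" if "y \<in> set_pmf \<sigma>" for y
    using mu_seq_abs_le[OF a B] that unfolding \<sigma>_def by blast
  have spread: "\<bar>y - y'\<bar> < b" if "y \<in> set_pmf \<sigma>" "y' \<in> set_pmf \<sigma>" for y y'
  proof -
    have "\<bar>y - y'\<bar> \<le> 2 * B * (a ^ L - 1)" using suppl[OF that(1)] suppl[OF that(2)] by linarith
    also have "\<dots> \<le> 2 * B * a ^ L" using B0 by (simp add: right_diff_distrib)
    also have "\<dots> < a ^ g * a ^ L" using g a by (intro mult_strict_right_mono) auto
    also have "\<dots> = b" by (simp add: b_def s_def power_add mult.commute)
    finally show ?thesis .
  qed
  have rate: "(1 - 2 * \<epsilon>) * s < L"
  proof -
    have "(1 - 2 * \<epsilon>) * s = L + g - 2 * \<epsilon> * L - 2 * \<epsilon> * g" by (simp add: s_def algebra_simps)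
    moreover have "2 * \<epsilon> * g \<ge> 0" using \<epsilon> by simp
    ultimately show ?thesis using L' by linarith
  qed
  define h where "h = H * ((1 - 2 * \<epsilon>) * s + L) / 2"
  have h1: "h < pmf_entropy \<sigma>"
  proof -
    have "h < H * L" using rate H(1) by (simp add: h_def)
    then show ?thesis using H(3)[of L] by (simp add: \<sigma>_def)
  qed
  have h2: "(1 - 2 * \<epsilon>) * s * H < h" using mult_strict_right_mono[OF rate H(1)] by (simp add: h_def algebra_simps)
  have "0 \<le> (1 - 2 * \<epsilon>) * s * H" using \<epsilon> H(1) by (intro mult_nonneg_nonneg) auto
  then have h0: "h > 0" using h2 by linarith
  obtain \<rho> where \<rho>: "0 < \<rho>" "\<rho> < 1"
    "\<And>\<theta>. 1 / (2 * real_of_int b) \<le> \<bar>\<theta> - of_int (round \<theta>)\<bar> \<Longrightarrow> norm (charfn \<mu> \<theta>) \<le> \<rho>"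
    using norm_charfn_bounded_away[OF fin gcd, of "1 / (2 * real_of_int b)"] b by (auto simp: divide_le_eq)
  obtain N0 where N0: "\<And>N. N \<ge> N0 \<Longrightarrow> \<exists>E \<subseteq> set_pmf (mu_seq b \<sigma> N).
     (\<Sum>x\<in>E. pmf (mu_seq b \<sigma> N) x) \<ge> 1 - \<epsilon> / 16 \<and> (\<forall>x\<in>E. pmf (mu_seq b \<sigma> N) x \<le> exp (- (h * N)))"
    using typical_set[OF fin\<sigma> spread h1, of "\<epsilon> / 16"] \<epsilon> by auto
  define \<gamma> where "\<gamma> = ln (1 / \<rho>)"
  have \<gamma>: "\<gamma> > 0" using \<rho> by (simp add: \<gamma>_def ln_div)
  define c where "c = 2 * real_of_int b + 1"
  have c: "c > 0" using b by (simp add: c_def)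
  \<comment> \<open>An upper bound for the logarithm of the number of sparse fractions; at most \<open>ln (1 / \<kappa>) / \<gamma>\<close> digits are
    nontrivial, where \<open>\<kappa> = \<epsilon> / (16 * sqrt n)\<close>.\<close>
  define U where "U n = ln 3 + (ln (16 / \<epsilon>) / \<gamma> + 1 / (2 * \<gamma>) * ln n) * ln (1 + c * n)" for n :: nat
  obtain K2 where K2: "\<forall>\<^sub>F n in sequentially. U n * (2 + U n) \<le> K2 * sqrt n"
    using polylog_le_sqrt[OF c, of "1 / (2 * \<gamma>)" "ln (16 / \<epsilon>) / \<gamma>"] \<gamma> unfolding U_def by auto
  define C1 where "C1 = ln (2 * real_of_int (B + 1)) + (L + 1) * ln (real_of_int a)"
  have lna: "ln (real_of_int a) > 0" using a by simp
  have "\<forall>\<^sub>F n in sequentially. (\<Sum>p\<in>bad_primes a \<mu> \<epsilon> n. ln (real p) / real p)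
     \<le> (ln (real_of_int a) + C1 + K2) * sqrt (real n)"
  proof -
    \<comment> \<open>From \<open>n1\<close> on, the loss of up to \<open>2 * s\<close> digits in \<open>N = n div (2 * s)\<close> is smaller than the gain in
      the choice of \<open>h\<close>; from \<open>n2\<close> on, \<open>b ^ (2 * N)\<close> exceeds the square of every bad prime.\<close>
    define n1 where "n1 = nat \<lceil>2 * h * s / (h - (1 - 2 * \<epsilon>) * s * H)\<rceil>"
    define n2 where "n2 = Suc (nat \<lceil>s / \<epsilon>\<rceil>)"
    have ev: "\<forall>\<^sub>F n in sequentially. n \<ge> 2 * s * N0 \<and> n \<ge> n1 \<and> n \<ge> n2 \<and> n \<ge> 1"
      by (intro eventually_conj eventually_ge_at_top)
    show ?thesis using ev K2
    proof eventually_elim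
      case (elim n)
      then have n: "n \<ge> 2 * s * N0" "n \<ge> n1" "n \<ge> n2" "n \<ge> 1" and Un: "U n * (2 + U n) \<le> K2 * sqrt n" by auto
      define N where "N = n div (2 * s)"
      define r where "r = n mod (2 * s)"
      have nN: "n = s * (2 * N) + r"
        using div_mult_mod_eq[of n "2 * s"] unfolding N_def r_def by (simp only: mult_ac)
      have "N \<ge> N0" unfolding N_def using n(1) s by (simp add: less_eq_div_iff_mult_less_eq mult.commute)
      define \<nu> where "\<nu> = mu_seq b \<sigma> N"
      have fin\<nu>: "finite (set_pmf \<nu>)" unfolding \<nu>_def by (rule finite_mu_seq[OF fin\<sigma>])
      obtain E where E: "E \<subseteq> set_pmf \<nu>" "(\<Sum>x\<in>E. pmf \<nu> x) \<ge> 1 - \<epsilon> / 16"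
        "\<And>x. x \<in> E \<Longrightarrow> pmf \<nu> x \<le> exp (- (h * N))"
        using N0[OF \<open>N \<ge> N0\<close>] unfolding \<nu>_def by blast
      have finE: "finite E" using E(1) fin\<nu> finite_subset by blast
      have E1: "(\<Sum>x\<in>E. pmf \<nu> x) \<le> 1" using sum_mono2[OF fin\<nu> E(1), of "pmf \<nu>"] sum_pmf_eq_1[OF fin\<nu> order_refl] by simp
      define S where "S = bad_primes a \<mu> \<epsilon> n"
      have finS: "finite S" unfolding S_def by (rule finite_bad_primes)
      have prm: "prime p" "p > 0" and small: "ln (real p) \<le> (1/2 - \<epsilon>) * H * n" and
        bad: "\<epsilon> \<le> l1_norm_mod p (\<lambda>x. pmf (mod_pmf (mu_seq a \<mu> n) p) x - pmf (unif_mod p) x)" if "p \<in> S" for p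
        using that prime_gt_0_nat by (auto simp: S_def bad_primes_def H_def)
      define off where "off p = (\<Sum>x\<in>E. \<Sum>y\<in>E. pmf \<nu> x * pmf \<nu> y * (if int p dvd x - y \<and> x \<noteq> y then 1 else 0))" for p
      define S0 where "S0 = {p \<in> S. int p dvd a}"
      define S1 where "S1 = {p \<in> S - S0. sqrt n / real p \<le> off p}"
      define S2 where "S2 = S - S0 - S1"
      have sq: "sqrt n \<ge> 1" using n(4) by simp
      have a0: "real_of_int a > 0" using a by simp
      have "(\<Sum>p\<in>S0. ln (real p) / real p) \<le> (\<Sum>p\<in>S0. ln (real p))"
      proof (rule sum_mono)
        fix p assume "p \<in> S0"
        then have "real p \<ge> 1" using prm(2)[of p] by (simp add: S0_def Suc_le_eq)
        then show "ln (real p) / real p \<le> ln (real p)" by (simp add: divide_le_eq mult_le_cancel_left1)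
      qed
      also have "\<dots> \<le> ln \<bar>real_of_int a\<bar>"
        using finS prm a by (intro sum_ln_prime_divisors_le) (auto simp: S0_def)
      finally have S0: "(\<Sum>p\<in>S0. ln (real p) / real p) \<le> ln (real_of_int a) * sqrt n"
        unfolding abs_of_pos[OF a0] using mult_left_mono[OF sq less_imp_le[OF lna]] by linarith
      \<comment> \<open>On these primes the sieve gives \<open>sqrt n * (\<Sum>p\<in>S1. ln p / p) = O(n)\<close>; the threshold \<open>sqrt n\<close> is
        harmless below because it only enters the number of sparse digits logarithmically.\<close>
      have S1: "(\<Sum>p\<in>S1. ln (real p) / real p) \<le> C1 * sqrt n"
      proof -
        define D where "D = 2 * real_of_int (B + 1) * real_of_int a ^ (L + n)"
        have "real_of_int \<bar>x - y\<bar> \<le> D" if "x \<in> E" "y \<in> E" for x y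
        proof -
          have A: "\<bar>z\<bar> \<le> B * a ^ (L + n)" if "z \<in> E" for z
          proof -
            have "\<bar>z\<bar> \<le> B * (a ^ L - 1) * (b ^ N - 1)"
              using mu_seq_abs_le[OF b suppl] that E(1) unfolding \<nu>_def by blast
            also have "\<dots> \<le> B * a ^ L * b ^ N" using B0 a b by (intro mult_mono) auto
            also have "\<dots> = B * a ^ (L + s * N)" by (simp add: b_def power_add power_mult)
            also have "\<dots> \<le> B * a ^ (L + n)" using B0 a nN by (intro mult_left_mono power_increasing) auto
            finally show ?thesis .
          qed
          have "\<bar>x - y\<bar> \<le> 2 * (B * a ^ (L + n))" using A[OF that(1)] A[OF that(2)] by linarith
          also have "\<dots> \<le> 2 * (B + 1) * a ^ (L + n)" using a by (simp add: algebra_simps)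
          finally have "\<bar>x - y\<bar> \<le> 2 * (B + 1) * a ^ (L + n)" .
          then have "real_of_int \<bar>x - y\<bar> \<le> real_of_int (2 * (B + 1) * a ^ (L + n))" by (simp only: of_int_le_iff)
          then show ?thesis by (simp add: D_def)
        qed
        moreover have "D \<ge> 1"
        proof -
          have "1 * 1 \<le> 2 * real_of_int (B + 1) * real_of_int a ^ (L + n)"
            using B0 a by (intro mult_mono one_le_power) auto
          then show ?thesis by (simp add: D_def)
        qed
        ultimately have "sqrt n * (\<Sum>p\<in>S1. ln (real p) / real p) \<le> ln D"
          using finE finS E1 prm(1) by (intro larger_sieve[of E S1 "pmf \<nu>"]) (auto simp: S1_def off_def)
        also have "ln D = ln (2 * real_of_int (B + 1)) + (L + n) * ln (real_of_int a)"
          unfolding D_def using B0 a by (subst ln_mult) (auto simp: ln_realpow)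
        also have "\<dots> \<le> C1 * n"
        proof -
          have "ln (2 * real_of_int (B + 1)) \<ge> 0" using B0 by (intro ln_ge_zero) simp
          then have "ln (2 * real_of_int (B + 1)) * 1 \<le> ln (2 * real_of_int (B + 1)) * n" using n(4) by (intro mult_left_mono) auto
          moreover have "(real L + n) * ln (real_of_int a) \<le> ((real L + 1) * n) * ln (real_of_int a)"
            using n(4) lna by (intro mult_right_mono) (auto simp: algebra_simps mult_le_cancel_left1)
          ultimately show ?thesis by (simp add: C1_def algebra_simps)
        qed
        also have "\<dots> = sqrt n * (C1 * sqrt n)" by (simp add: mult_ac)
        finally show ?thesis using sq by simp
      qed
      have S2: "(\<Sum>p\<in>S2. ln (real p) / real p) \<le> K2 * sqrt n"
      proof -
        define \<kappa> where "\<kappa> = \<epsilon> / (16 * sqrt n)"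
        have \<kappa>: "\<kappa> > 0" using \<epsilon> n(4) by (simp add: \<kappa>_def)
        define R where "R = nat \<lfloor>ln (1 / \<kappa>) / \<gamma>\<rfloor>"
        have ln\<kappa>: "ln (1 / \<kappa>) = ln (16 / \<epsilon>) + ln n / 2"
          using \<epsilon> n(4) by (simp add: \<kappa>_def ln_div ln_mult ln_sqrt)
        have ln\<kappa>0: "ln (1 / \<kappa>) \<ge> 0" unfolding ln\<kappa> using \<epsilon> n(4) by (intro add_nonneg_nonneg ln_ge_zero) (auto simp: le_divide_eq)
        have nh: "(1 - 2 * \<epsilon>) * H * n \<le> 2 * (h * N)"
        proof -
          have d: "h - (1 - 2 * \<epsilon>) * s * H > 0" using h2 by simp
          have "2 * h * s / (h - (1 - 2 * \<epsilon>) * s * H) \<le> n" using n(2) by (simp add: n1_def)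
          then have 1: "2 * h * s \<le> n * (h - (1 - 2 * \<epsilon>) * s * H)" using d by (simp add: divide_le_eq)
          have "r < 2 * s" unfolding r_def using s by simp
          then have "real n \<le> 2 * s * N + 2 * s" using nN by (simp flip: of_nat_mult of_nat_add)
          then have "h * n \<le> h * (2 * s * N + 2 * s)" using h0 by (intro mult_left_mono) auto
          then have "s * ((1 - 2 * \<epsilon>) * H * n) \<le> s * (2 * (h * N))" using 1 by (simp add: algebra_simps)
          then show ?thesis using s by simp
        qed
        \<comment> \<open>This is where the entropy bound \<open>H \<le> ln a\<close> is needed.\<close>
        have Qb: "(exp ((1/2 - \<epsilon>) * H * n))\<^sup>2 < of_int b ^ (2 * N)"
        proof -
          have "s / \<epsilon> < n2" unfolding n2_def by linarith
          then have "s / \<epsilon> < n" using n(3) by linarith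
          then have ns: "s < \<epsilon> * n" using \<epsilon> by (simp add: field_simps)
          have "r < 2 * s" unfolding r_def using s by simp
          then have n': "real n - 2 * s < real (s * (2 * N))" using nN by linarith
          have "(1 - 2 * \<epsilon>) * n * H \<le> (1 - 2 * \<epsilon>) * n * ln (real_of_int a)"
            using H(2) \<epsilon> by (intro mult_left_mono) auto
          also have "\<dots> < real (s * (2 * N)) * ln (real_of_int a)"
          proof (rule mult_strict_right_mono[OF _ lna])
            have "(1 - 2 * \<epsilon>) * n = n - 2 * (\<epsilon> * n)" by (simp add: algebra_simps)
            then show "(1 - 2 * \<epsilon>) * n < real (s * (2 * N))" using ns n' by linarith
          qed
          finally have "exp ((1 - 2 * \<epsilon>) * n * H) < exp (real (s * (2 * N)) * ln (real_of_int a))" by simp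
          moreover have "(exp ((1/2 - \<epsilon>) * H * n))\<^sup>2 = exp ((1 - 2 * \<epsilon>) * n * H)"
            by (simp add: power2_eq_square algebra_simps flip: exp_add)
          moreover have "exp (real (s * (2 * N)) * ln (real_of_int a)) = of_int b ^ (2 * N)"
            unfolding exp_of_nat_mult exp_ln[OF a0] by (simp add: b_def power_mult)
          ultimately show ?thesis by (simp only:)
        qed
        have "card S2 \<le> 2 * (1 + nat (2 * b + 1) * (2 * N)) ^ R"
        proof (rule card_primes_with_sparse_fraction[OF _ Qb])
          show "b > 0" using b by simp
          fix p assume p: "p \<in> S2"
          then have pS: "p \<in> S" and nd: "\<not> int p dvd a" and off: "off p < sqrt n / real p" by (auto simp: S2_def S0_def S1_def)
          note pp = prm[OF pS]
          have "real p = exp (ln (real p))" using pp by simp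
          also have "\<dots> \<le> exp ((1/2 - \<epsilon>) * H * n)" using small[OF pS] by simp
          finally have pQ: "real p \<le> exp ((1/2 - \<epsilon>) * H * n)" .
          have "ln p \<le> h * N" using small[OF pS] nh by (simp add: algebra_simps)
          then have "exp (- (h * N)) \<le> exp (- ln p)" by simp
          also have "\<dots> = 1 / p" using pp by (simp add: exp_minus inverse_eq_divide)
          finally have "pmf \<nu> x \<le> 1 / p" if "x \<in> E" for x using E(3)[OF that] by linarith
          then have "(\<Sum>x\<in>E. \<Sum>y\<in>E. pmf \<nu> x * pmf \<nu> y * (if int p dvd x - y then 1 else 0)) \<le> off p + 1 / p"
            unfolding off_def by (intro collision_sum_le finE E1)
          also have "\<dots> \<le> 2 * sqrt n / p"
            using off divide_right_mono[OF sq, of "real p"] by simp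
          finally have coll: "(\<Sum>x\<in>E. \<Sum>y\<in>E. pmf \<nu> x * pmf \<nu> y * (if int p dvd x - y then 1 else 0)) \<le> 2 * sqrt n / p" .
          have "\<exists>\<xi>. 0 < \<xi> \<and> \<xi> < p \<and> \<kappa> < \<rho> ^ far_count b (2 * N) (real \<xi> / real p)"
            using bad[OF pS] E coll \<epsilon> \<rho> n(4) sq unfolding \<kappa>_def b_def s_def \<nu>_def \<sigma>_def nN
            by (intro sparse_fraction_of_bad_prime[OF fin g(2) _ _ _ pp(1) nd]) auto
          then show "prime p \<and> real p \<le> exp ((1/2 - \<epsilon>) * H * n) \<and> (\<exists>\<xi>. 0 < \<xi> \<and> \<xi> < p \<and> far_count b (2 * N) (real \<xi> / real p) \<le> R)"
            using pp pQ le_floor_of_less_power[OF \<kappa> \<rho>(1,2)] unfolding R_def \<gamma>_def by blast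
        qed
        moreover define T where "T = 3 * (1 + nat (2 * b + 1) * (2 * N)) ^ R"
        ultimately have T: "card S2 \<le> T" "3 \<le> T" by (simp_all add: T_def)
        then have "(\<Sum>p\<in>S2. ln (real p) / real p) \<le> ln T * (2 + ln T)"
          using finS prm(2) by (intro sum_ln_over_le) (auto simp: S2_def)
        also have "\<dots> \<le> U n * (2 + U n)"
        proof -
          have T0: "ln T \<ge> 0" using T(2) by (intro ln_ge_zero) simp
          have "ln T = ln 3 + R * ln (1 + c * (2 * N))"
          proof -
            have "real (nat (2 * b + 1)) = c" using b by (simp add: c_def)
            then have "real T = 3 * (1 + c * (2 * N)) ^ R" by (simp add: T_def)
            moreover have "1 + c * (2 * N) > 0" using c by (intro add_pos_nonneg mult_nonneg_nonneg) auto
            ultimately show ?thesis by (simp add: ln_mult ln_realpow)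
          qed
          also have "\<dots> \<le> ln 3 + (ln (1 / \<kappa>) / \<gamma>) * ln (1 + c * n)"
          proof (intro add_left_mono mult_mono)
            show "real R \<le> ln (1 / \<kappa>) / \<gamma>" unfolding R_def using ln\<kappa>0 \<gamma> by simp
            have "1 * (2 * N) \<le> s * (2 * N)" using s by (intro mult_right_mono) auto
            then have "2 * N \<le> n" using nN by linarith
            then have "c * real (2 * N) \<le> c * n" using c by (intro mult_left_mono) auto
            moreover have "c * real (2 * N) \<ge> 0" using c by simp
            ultimately show "ln (1 + c * real (2 * N)) \<le> ln (1 + c * n)" by (intro ln_mono) linarith+
            show "0 \<le> ln (1 + c * real (2 * N))" using \<open>c * real (2 * N) \<ge> 0\<close> by (intro ln_ge_zero) linarith
          qed (use ln\<kappa>0 \<gamma> in simp)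
          also have "\<dots> = U n" unfolding U_def ln\<kappa> using \<gamma> by (simp add: field_simps)
          finally show ?thesis using T0 by (intro mult_mono) auto
        qed
        also have "\<dots> \<le> K2 * sqrt n" by (rule Un)
        finally show ?thesis .
      qed
      have "S0 \<subseteq> S" "S1 \<subseteq> S - S0" by (auto simp: S0_def S1_def)
      then have "(\<Sum>p\<in>S. ln (real p) / real p) =
          (\<Sum>p\<in>S2. ln (real p) / real p) + (\<Sum>p\<in>S1. ln (real p) / real p) + (\<Sum>p\<in>S0. ln (real p) / real p)"
        using finS sum.subset_diff[of S0 S "\<lambda>p. ln (real p) / real p"]
          sum.subset_diff[of S1 "S - S0" "\<lambda>p. ln (real p) / real p"]
        unfolding S2_def by simp
      then show ?case using S0 S1 S2 unfolding S_def by (simp add: distrib_right)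
    qed
  qed
  then show ?thesis by blast
qed

text \<open>If \<open>\<epsilon> \<ge> 1 / 2\<close> or \<open>H = 0\<close>, the bound on \<open>ln p\<close> is at most \<open>0\<close> and there are no bad primes.\<close>

theorem theorem1p2:
  fixes a :: int and \<mu> :: "int pmf" and \<epsilon> :: real
  assumes "a > 1"
    and "finite (set_pmf \<mu>)"
    and "Gcd {x - y | x y. x \<in> set_pmf \<mu> \<and> y \<in> set_pmf \<mu>} = 1"
    and "\<epsilon> > 0"
  shows "\<exists>K::real. \<forall>n::nat. n \<ge> 1 \<longrightarrow>
    (\<Sum>p\<in>bad_primes a \<mu> \<epsilon> n. ln (real p) / real p) \<le> K * sqrt (real n)"
proof (cases "\<epsilon> < 1 / 2 \<and> asymp_entropy a \<mu> > 0")
  case True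
  then show ?thesis
    using bad_primes_sum_bound[OF assms] sqrt_bound_from_eventual[of "\<lambda>n. \<Sum>p\<in>bad_primes a \<mu> \<epsilon> n. ln (real p) / real p"]
    by auto
next
  case False
  have small: "(1/2 - \<epsilon>) * asymp_entropy a \<mu> * real n \<le> 0" for n
  proof (cases "\<epsilon> < 1 / 2")
    case True
    then have "asymp_entropy a \<mu> = 0" using False asymp_entropy_nonneg[OF assms(1,2)] by simp
    then show ?thesis by simp
  next
    case False
    then show ?thesis using asymp_entropy_nonneg[OF assms(1,2)] by (intro mult_nonpos_nonneg) auto
  qed
  have "p \<notin> bad_primes a \<mu> \<epsilon> n" for p n
  proof
    assume "p \<in> bad_primes a \<mu> \<epsilon> n"
    then have "prime p" "ln (real p) \<le> (1/2 - \<epsilon>) * asymp_entropy a \<mu> * real n"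
      by (simp_all add: bad_primes_def)
    moreover have "ln (real p) > 0" using prime_gt_1_nat[OF \<open>prime p\<close>] by simp
    ultimately show False using small[of n] by linarith
  qed
  then have "bad_primes a \<mu> \<epsilon> n = {}" for n by blast
  then show ?thesis by (intro exI[of _ 0]) simp
qed

end
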